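(* Let $q$ be a prime power, let $d\ge 0$ and $m\ge 1$ be integers with $m\le 2$, and let $a_1\le\dots\le a_m$ be positive integers (ordered in this way) such that $\operatorname{lcm}(a_1,\dots,a_m)\mid d$. Then $$e_q(d;1,a_1,\dots,a_m)=\min\left\{p_m,\ \frac{d}{a_1}q^{m-1}+p_{m-2}\right\}.$$
   Context: For an integer $r\ge 0$ put $p_r=q^r+q^{r-1}+\dots+1$, and $p_r=0$ for $r<0$. For positive integers $a_0,\dots,a_m$ the weighted projective space is $\mathbb{P}(a_0,\dots,a_m)=(\overline{\mathbb{F}}_q^{\,m+1}\setminus\{0\})/\sim$, where $(x_0,\dots,x_m)\sim(\lambda^{a_0}x_0,\dots,\lambda^{a_m}x_m)$ for all $\lambda\in\overline{\mathbb{F}}_q^{\,*}$. The class of $(x_0,\dots,x_m)$ is written $(x_0:\dots:x_m)$. It is $\mathbb{F}_q$-rational if $(x_0:\dots:x_m)=(x_0^q:\dots:x_m^q)$; every $\mathbb{F}_q$-rational point has exactly $q-1$ representatives in $\mathbb{F}_q^{m+1}\setminus\{0\}$. A polynomial $F\in\mathbb{F}_q[X_0,\dots,X_m]$ is weighted homogeneous of degree $d$ if it is homogeneous of degree $d$ for the grading in which $X_i$ has degree $a_i$, and $V(F)$ denotes the set of $\mathbb{F}_q$-rational points of $\mathbb{P}(a_0,\dots,a_m)$ at which $F$ vanishes. Finally, $e_q(d;a_0,\dots,a_m)$ is the maximum of $|V(F)|$ over all nonzero weighted homogeneous polynomials $F\in\mathbb{F}_q[X_0,\dots,X_m]$ of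 degree $d$ (defined when such polynomials exist). In the claim the weights are $(a_0,a_1,\dots,a_m)$ with $a_0=1$.
   Formalization: For m = 2 the formal theorem also assumes d > 0: when d = 0 and m = 2 only nonzero constants qualify, so the maximum is 0 while the right-hand side equals 1, and the claim as stated is false in exactly that case. *)

theory Defs
  imports "HOL-Algebra.Algebraic_Closure_Type" "HOL-Library.Poly_Mapping" "HOL-Library.Cardinality"
begin

definition p_num :: "nat \<Rightarrow> int \<Rightarrow> nat" where
  "p_num q r = (if r < 0 then 0 else \<Sum>i\<le>nat r. q ^ i)"


(* The finite field is a type 'a of class {field, finite}; its order is CARD('a), and its
   algebraic closure is 'a alg_closure. A tuple (x_0, ..., x_m) is encoded as a function on
   nat that vanishes beyond m. Weights are a function w on nat of which only w 0, ..., w m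
   are relevant. *)

definition nonzero_tuples :: "nat \<Rightarrow> (nat \<Rightarrow> 'k::field) set" where
  "nonzero_tuples m = {x. (\<forall>i>m. x i = 0) \<and> (\<exists>i\<le>m. x i \<noteq> 0)}"

definition wproj_rel :: "(nat \<Rightarrow> nat) \<Rightarrow> nat \<Rightarrow> ((nat \<Rightarrow> 'k::field) \<times> (nat \<Rightarrow> 'k)) set" where
  "wproj_rel w m = {(x, y). x \<in> nonzero_tuples m \<and> y \<in> nonzero_tuples m \<and>
     (\<exists>l. l \<noteq> 0 \<and> (\<forall>i\<le>m. y i = l ^ w i * x i))}"

definition wproj_space :: "(nat \<Rightarrow> nat) \<Rightarrow> nat \<Rightarrow> (nat \<Rightarrow> 'a::field alg_closure) set set" where
  "wproj_space w m = nonzero_tuples m // wproj_rel w m"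

definition wproj_point :: "(nat \<Rightarrow> nat) \<Rightarrow> nat \<Rightarrow> (nat \<Rightarrow> 'k::field) \<Rightarrow> (nat \<Rightarrow> 'k) set" where
  "wproj_point w m x = wproj_rel w m `` {x}"

definition wproj_rational_points ::
    "(nat \<Rightarrow> nat) \<Rightarrow> nat \<Rightarrow> (nat \<Rightarrow> 'a::{field,finite} alg_closure) set set" where
  "wproj_rational_points w m =
     {P \<in> wproj_space w m. \<forall>x\<in>P. wproj_point w m x = wproj_point w m (\<lambda>i. x i ^ CARD('a))}"


(* A monomial is its exponent vector, of type nat \<Rightarrow>\<^sub>0 nat; polynomials in the countably many
   variables X_0, X_1, ... are finitely supported coefficient functions on monomials. *)

type_synonym 'a mpoly = "(nat \<Rightarrow>\<^sub>0 nat) \<Rightarrow>\<^sub>0 'a"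

definition mpolys :: "nat \<Rightarrow> 'a::field mpoly set" where
  "mpolys m = {F. \<forall>\<alpha>\<in>Poly_Mapping.keys F. Poly_Mapping.keys \<alpha> \<subseteq> {..m}}"

definition mpoly_eval :: "'a::field mpoly \<Rightarrow> (nat \<Rightarrow> 'a alg_closure) \<Rightarrow> 'a alg_closure" where
  "mpoly_eval F x = (\<Sum>\<alpha>\<in>Poly_Mapping.keys F. to_ac (Poly_Mapping.lookup F \<alpha>) * (\<Prod>i\<in>Poly_Mapping.keys \<alpha>. x i ^ Poly_Mapping.lookup \<alpha> i))"

definition weighted_homogeneous :: "(nat \<Rightarrow> nat) \<Rightarrow> nat \<Rightarrow> 'a::field mpoly \<Rightarrow> bool" where
  "weighted_homogeneous w d F \<longleftrightarrow> (\<forall>\<alpha>\<in>Poly_Mapping.keys F. (\<Sum>i\<in>Poly_Mapping.keys \<alpha>. w i * Poly_Mapping.lookup \<alpha> i) = d)"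


(* For weighted homogeneous F, vanishing does not depend on the representative x of P. *)
definition V :: "(nat \<Rightarrow> nat) \<Rightarrow> nat \<Rightarrow> 'a::{field,finite} mpoly \<Rightarrow> (nat \<Rightarrow> 'a alg_closure) set set" where
  "V w m F = {P \<in> wproj_rational_points w m. \<forall>x\<in>P. mpoly_eval F x = 0}"

(* Max is unspecified for the empty set, so this is meaningful only if nonzero weighted
   homogeneous polynomials of degree d exist. For positive weights and d = 0 only the nonzero
   constants qualify, and the maximum is 0. *)
definition e_max :: "'a::{field,finite} itself \<Rightarrow> nat \<Rightarrow> (nat \<Rightarrow> nat) \<Rightarrow> nat \<Rightarrow> nat" where
  "e_max TYPE('a) d w m =
     Max {card (V w m F) | F :: 'a mpoly.
            F \<in> mpolys m \<and> F \<noteq> 0 \<and> weighted_homogeneous w d F}"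

end

theory Submission
  imports Defs
begin

text \<open>
Write \<open>d = a\<^sub>1 k\<close> and let \<open>q\<close> be the order of the field. Since \<open>X\<^sub>0\<close> has weight 1, the rational
points with \<open>x\<^sub>0 \<noteq> 0\<close> form an affine space over \<open>F\<^sub>q\<close>. For \<open>m = 1\<close> there is one further point
\<open>(0:1)\<close>, and a form of degree \<open>d\<close> is a univariate polynomial of degree at most \<open>k\<close> which vanishes at
\<open>(0:1)\<close> iff its coefficient at \<open>k\<close> is zero; so it has at most \<open>k\<close> zeros.

For \<open>m = 2\<close> the points with \<open>x\<^sub>0 = 0\<close> are \<open>(0:0:1)\<close> and, for each \<open>\<tau> \<in> F\<^sub>q\<close>, one point \<open>(0:1:z)\<close>, where
\<open>\<tau> = z\<^sup>e\<close> with \<open>e = a\<^sub>1 / gcd(a\<^sub>1, a\<^sub>2)\<close> (lemma \<open>card_V_2\<close>). On the affine part a form \<open>F\<close> becomes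
\<open>f(y,z) = F(1,y,z)\<close>, whose monomials \<open>y\<^sup>iz\<^sup>j\<close> satisfy \<open>a\<^sub>1 i + a\<^sub>2 j \<le> d\<close>, and at infinity a polynomial
\<open>H(\<tau>)\<close>.

For the upper bound \<open>kq + 1\<close>, relevant when \<open>k \<le> q\<close>, let \<open>J\<close> be the degree of \<open>f\<close> in \<open>z\<close> and \<open>r\<close> the
number of lines \<open>y = c\<close> on which \<open>f\<close> is identically zero. Counting line by line gives at most
\<open>rq + (q - r)J\<close> affine zeros. The leading coefficient of \<open>f\<close> in \<open>z\<close> vanishes at \<open>r\<close> points, so
\<open>a\<^sub>1 r + a\<^sub>2 J \<le> d\<close> and hence \<open>r + J \<le> k\<close>. If \<open>H = 0\<close> then \<open>f\<close> has smaller
weighted degree, so \<open>r + J \<le> k - 1\<close>, and even all \<open>q + 1\<close> points at infinity are harmless. If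
\<open>H \<noteq> 0\<close>, there are at most \<open>J + 1\<close> zeros at infinity, and elementary arithmetic (\<open>pencil_bound\<close>)
suffices unless \<open>r = 0\<close> and \<open>J = k\<close>.

In that last case \<open>a\<^sub>1 = a\<^sub>2\<close>, so \<open>f\<close> is an ordinary plane curve of degree \<open>k\<close> not passing through the
point \<open>(0:0:1)\<close>, the common direction of the lines \<open>y = c\<close>. Without zeros at infinity the line count
is enough. Otherwise it is repeated with the lines through a zero \<open>(0:1:t)\<close> of \<open>F\<close>
at infinity, that is, after the shear \<open>z = ty + u\<close> (\<open>card_zeros_plane_curve_le\<close>): now the
curve passes through the centre of the pencil, so the degree along its lines is less than \<open>k\<close>.

Equality holds for forms in \<open>X\<^sub>0\<close> and \<open>X\<^sub>1\<close> only: for \<open>k \<le> q\<close> the homogenisation of a product of \<open>k\<close>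
distinct factors \<open>y - c\<close>, and for \<open>k > q\<close> that of the product of all \<open>q\<close> factors, multiplied by the
remaining power of \<open>X\<^sub>0\<close>, which makes all points at infinity zeros.
\<close>

section \<open>Zeros of plane curves, counted along pencils of lines\<close>

text \<open>A bivariate polynomial \<open>f(y,z)\<close> is an \<open>'a poly poly\<close> with \<open>z\<close> as the outer variable, because the
count below fixes \<open>y\<close> and regards \<open>f\<close> as a polynomial in \<open>z\<close>.\<close>

definition slice :: "'a::field poly poly \<Rightarrow> 'a \<Rightarrow> 'a poly" where
  "slice f y = map_poly (\<lambda>e. poly e y) f"

lemma coeff_slice [simp]: "coeff (slice f y) j = poly (coeff f j) y"
  by (simp add: slice_def coeff_map_poly)

lemma degree_slice_le: "degree (slice f y) \<le> degree f"
  by (rule degree_le) (simp add: coeff_eq_0)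

definition zeros2 :: "'a::field poly poly \<Rightarrow> ('a \<times> 'a) set" where
  "zeros2 f = {(y, z). poly (slice f y) z = 0}"

text \<open>The number \<open>r\<close> counts the lines \<open>y = c\<close> contained in the curve. On each of the other lines there are at
most \<open>degree f\<close> zeros. A contained line kills every coefficient of \<open>f\<close>, in particular the leading
one, which bounds \<open>r\<close> by its degree.\<close>

lemma card_zeros2_le:
  fixes f :: "'a::{field,finite} poly poly"
  assumes "f \<noteq> 0"
  obtains r where "r \<le> degree (lead_coeff f)" and "r \<le> CARD('a)"
    and "card (zeros2 f) \<le> r * CARD('a) + (CARD('a) - r) * degree f"
proof
  define B where "B = {y. slice f y = 0}"
  have "B \<subseteq> {y. poly (lead_coeff f) y = 0}"
  proof
    fix y assume "y \<in> B"
    then have "coeff (slice f y) (degree f) = 0" by (simp add: B_def)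
    then show "y \<in> {y. poly (lead_coeff f) y = 0}" by simp
  qed
  then have "card B \<le> card {y. poly (lead_coeff f) y = 0}"
    by (intro card_mono) auto
  also have "\<dots> \<le> degree (lead_coeff f)"
    using assms by (intro card_poly_roots_bound) simp
  finally show "card B \<le> degree (lead_coeff f)" .
  show "card B \<le> CARD('a)"
    by (intro card_mono) auto
  have "zeros2 f = (SIGMA y:UNIV. {z. poly (slice f y) z = 0})"
    by (auto simp: zeros2_def)
  then have "card (zeros2 f) = (\<Sum>y\<in>UNIV. card {z. poly (slice f y) z = 0})"
    by simp
  also have "\<dots> = (\<Sum>y\<in>B. card {z. poly (slice f y) z = 0}) + (\<Sum>y\<in>-B. card {z. poly (slice f y) z = 0})"
    by (subst sum.union_disjoint [symmetric]) auto
  also have "\<dots> \<le> (\<Sum>y\<in>B. CARD('a)) + (\<Sum>y\<in>-B. degree f)"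
  proof (intro add_mono sum_mono)
    fix y assume "y \<in> -B"
    then have "card {z. poly (slice f y) z = 0} \<le> degree (slice f y)"
      by (intro card_poly_roots_bound) (simp add: B_def)
    then show "card {z. poly (slice f y) z = 0} \<le> degree f"
      using degree_slice_le order_trans by blast
  qed (auto intro: card_mono)
  also have "\<dots> = card B * CARD('a) + (CARD('a) - card B) * degree f"
    by (simp add: Compl_eq_Diff_UNIV card_Diff_subset)
  finally show "card (zeros2 f) \<le> card B * CARD('a) + (CARD('a) - card B) * degree f" .
qed

text \<open>Here \<open>A\<close> stands for the affine zeros and \<open>T\<close> for those at infinity. If \<open>r + J < k\<close>, a whole \<open>q\<close> is
left over to pay for \<open>J \<le> q\<close>. If \<open>r + J = k\<close>, the saving is \<open>rJ\<close>, which is at least \<open>J\<close> as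
soon as \<open>r > 0\<close>.\<close>

lemma pencil_bound:
  fixes q r J k A T :: nat
  assumes "A \<le> r * q + (q - r) * J" and "T \<le> J + 1"
    and "r + J \<le> k" and "r + J < k \<or> 0 < r" and "r \<le> q" and "k \<le> q"
  shows "A + T \<le> k * q + 1"
proof -
  obtain s where q: "q = r + s" using \<open>r \<le> q\<close> le_Suc_ex by blast
  have *: "A + T \<le> r * q + s * J + J + 1" using assms(1,2) q by simp
  show ?thesis
  proof (cases "r + J < k")
    case True
    then have "(r + J + 1) * q \<le> k * q" by (intro mult_right_mono) auto
    moreover have "r * q + s * J + J \<le> (r + J + 1) * q"
      using True \<open>k \<le> q\<close> by (simp add: q algebra_simps)
    ultimately show ?thesis using * by linarith
  next
    case False
    then have k: "k = r + J" and "0 < r" using assms(3,4) by auto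
    then have "J \<le> r * J" by simp
    then have "r * q + s * J + J \<le> k * q" by (simp add: q k algebra_simps)
    then show ?thesis using * by linarith
  qed
qed

lemma poly_eq_sum_le:
  fixes p :: "'a::comm_semiring_1 poly"
  assumes "degree p \<le> n"
  shows "poly p x = (\<Sum>i\<le>n. coeff p i * x ^ i)"
  unfolding poly_altdef using assms
  by (intro sum.mono_neutral_left) (auto simp: coeff_eq_0)

definition poly2_of :: "nat \<Rightarrow> (nat \<Rightarrow> nat \<Rightarrow> 'a::field) \<Rightarrow> 'a poly poly" where
  "poly2_of k c = (\<Sum>j\<le>k. monom (\<Sum>i\<le>k-j. monom (c i j) i) j)"

lemma coeff_poly2_of: "coeff (coeff (poly2_of k c) j) i = (if i + j \<le> k then c i j else 0)"
  by (auto simp: poly2_of_def coeff_sum sum.delta)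

definition total_degree_le :: "nat \<Rightarrow> 'a::field poly poly \<Rightarrow> bool" where
  "total_degree_le k f \<longleftrightarrow> (\<forall>i j. coeff (coeff f j) i \<noteq> 0 \<longrightarrow> i + j \<le> k)"

lemma total_degree_le_poly2_of: "total_degree_le k (poly2_of k c)"
  by (auto simp: total_degree_le_def coeff_poly2_of split: if_splits)

lemma degree_le_of_total_degree_le:
  assumes "total_degree_le k f"
  shows "degree f \<le> k" and "f \<noteq> 0 \<Longrightarrow> degree (lead_coeff f) + degree f \<le> k"
    and "degree (coeff f j) \<le> k - j"
proof -
  have *: "degree (coeff f j) + j \<le> k" if "coeff f j \<noteq> 0" for j
    using assms that unfolding total_degree_le_def by (metis leading_coeff_0_iff)
  show "f \<noteq> 0 \<Longrightarrow> degree (lead_coeff f) + degree f \<le> k"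
    using *[of "degree f"] by simp
  then show "degree f \<le> k" by (cases "f = 0") auto
  show "degree (coeff f j) \<le> k - j"
    using *[of j] by (cases "coeff f j = 0") auto
qed

text \<open>The homogeneous component of degree \<open>s\<close> is stored as the univariate polynomial obtained by setting
\<open>y = 1\<close>. In this form the shear \<open>z = ty + u\<close> acts on each component by the translation
\<open>X \<mapsto> X + t\<close>, and \<open>homog_eval\<close> recovers the values of the component.\<close>

definition homog_comp :: "'a::field poly poly \<Rightarrow> nat \<Rightarrow> 'a poly" where
  "homog_comp f s = (\<Sum>j\<le>s. monom (coeff (coeff f j) (s - j)) j)"

lemma coeff_homog_comp: "coeff (homog_comp f s) j = (if j \<le> s then coeff (coeff f j) (s - j) else 0)"
  by (auto simp: homog_comp_def coeff_sum sum.delta)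

lemma degree_homog_comp_le: "degree (homog_comp f s) \<le> s"
  by (rule degree_le) (simp add: coeff_homog_comp)

definition homog_eval :: "nat \<Rightarrow> 'a::field poly \<Rightarrow> 'a \<Rightarrow> 'a \<Rightarrow> 'a" where
  "homog_eval s p y z = (\<Sum>j\<le>s. coeff p j * y ^ (s - j) * z ^ j)"

text \<open>For \<open>y \<noteq> 0\<close> the homogeneous polynomial is \<open>y\<^sup>s p(z/y)\<close> and the claim is \<open>(ty + u)/y = t + u/y\<close>. For
\<open>y = 0\<close> only the coefficient at \<open>s\<close> matters, and translation preserves it.\<close>

lemma homog_eval_shear:
  fixes p :: "'a::field poly"
  assumes "degree p \<le> s"
  shows "homog_eval s (p \<circ>\<^sub>p [:t, 1:]) y u = homog_eval s p y (t * y + u)"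
proof (cases "y = 0")
  case False
  have *: "homog_eval s p y z = y ^ s * poly p (z / y)" if "degree p \<le> s" for p z
  proof -
    have "poly p (z / y) = (\<Sum>j\<le>s. coeff p j * (z / y) ^ j)"
      by (rule poly_eq_sum_le) (rule that)
    then show ?thesis
      using False by (auto simp: homog_eval_def sum_distrib_left power_divide power_diff intro!: sum.cong)
  qed
  have "degree (p \<circ>\<^sub>p [:t, 1:]) \<le> s" using assms by (simp add: degree_pcompose)
  then show ?thesis
    using False assms by (simp add: * poly_pcompose add_divide_distrib)
next
  case True
  have *: "homog_eval s p 0 z = coeff p s * z ^ s" for p z
    by (simp add: homog_eval_def power_0_left sum.delta if_distrib [of "\<lambda>x. _ * x"]
        if_distrib [of "\<lambda>x. x * _"] cong: if_cong)
  have "coeff (p \<circ>\<^sub>p [:t, 1:]) s = coeff p s"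
  proof (cases "degree p = s")
    case True
    then show ?thesis
      using lead_coeff_comp[of "[:t, 1:]" p] by (simp add: degree_pcompose)
  next
    case False
    then show ?thesis using assms by (simp add: degree_pcompose coeff_eq_0)
  qed
  then show ?thesis by (simp add: * True)
qed

lemma poly_slice_by_degree:
  assumes "total_degree_le k f"
  shows "poly (slice f y) z = (\<Sum>s\<le>k. \<Sum>j\<le>s. coeff (coeff f j) (s - j) * y ^ (s - j) * z ^ j)"
proof -
  have "poly (slice f y) z = (\<Sum>j\<le>k. poly (coeff f j) y * z ^ j)"
    using degree_slice_le[of f y] degree_le_of_total_degree_le(1)[OF assms]
    by (subst poly_eq_sum_le[of _ k]) auto
  also have "\<dots> = (\<Sum>j\<le>k. \<Sum>i\<le>k-j. coeff (coeff f j) i * y ^ i * z ^ j)"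
    by (simp add: poly_eq_sum_le[OF degree_le_of_total_degree_le(3)[OF assms]] sum_distrib_right)
  also have "\<dots> = (\<Sum>(j, i)\<in>{(j, i). j + i \<le> k}. coeff (coeff f j) i * y ^ i * z ^ j)"
    by (subst sum.Sigma) (auto intro!: sum.cong)
  also have "\<dots> = (\<Sum>s\<le>k. \<Sum>j\<le>s. coeff (coeff f j) (s - j) * y ^ (s - j) * z ^ j)"
    by (rule sum.triangle_reindex_eq)
  finally show ?thesis .
qed

text \<open>For a plane curve of degree \<open>k\<close>, the roots of the top component are its points at infinity other
than \<open>(0:0:1)\<close>. Counting along the lines \<open>z = ty + u\<close> through such a root \<open>t\<close> amounts to counting for the
sheared polynomial \<open>g(u,y) = f(y, ty + u)\<close> along the lines of constant \<open>u\<close>. Its coefficient at \<open>y\<^sup>k\<close> is the value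
of the top component at \<open>t\<close>, hence zero, so its degree \<open>J\<close> in \<open>y\<close> is less than \<open>k\<close>. Since the
monomials of degree \<open>k\<close> in \<open>g\<close> involve \<open>y\<close> at most to the power \<open>J\<close>, the top component has at most
\<open>J\<close> roots besides \<open>t\<close>.\<close>

lemma card_zeros_plane_curve_le:
  fixes f :: "'a::{field,finite} poly poly"
  assumes deg: "total_degree_le k f" and "k \<le> CARD('a)"
    and h0: "homog_comp f k \<noteq> 0" and root: "poly (homog_comp f k) t = 0"
  shows "card (zeros2 f) + card {x. poly (homog_comp f k) x = 0} \<le> k * CARD('a) + 1"
proof -
  define H where "H s = homog_comp f s \<circ>\<^sub>p [:t, 1:]" for s
  define g where "g = poly2_of k (\<lambda>l i. coeff (H (i + l)) l)"
  have degH: "degree (H s) \<le> s" for s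
    using degree_homog_comp_le[of f s] by (simp add: H_def degree_pcompose)
  have g: "coeff (coeff g i) l = (if l + i \<le> k then coeff (H (i + l)) l else 0)" for i l
    by (simp add: g_def coeff_poly2_of)
  have degg: "total_degree_le k g" by (simp add: g_def total_degree_le_poly2_of)
  have "H k \<noteq> 0" using h0 by (simp add: H_def pcompose_eq_0_iff)
  then obtain l where l: "coeff (H k) l \<noteq> 0" by (metis leading_coeff_0_iff)
  then have "l \<le> k" using degH[of k] le_degree order_trans by blast
  then have "coeff (coeff g (k - l)) l \<noteq> 0" using l by (simp add: g)
  then have "g \<noteq> 0" by auto
  have "coeff g k = 0"
    using root by (intro poly_eqI) (auto simp: g H_def pcompose_coeff_0)
  then have J: "degree g < k"
    using \<open>g \<noteq> 0\<close> degree_le_of_total_degree_le(1)[OF degg]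
    by (metis le_neq_implies_less leading_coeff_0_iff)
  have "poly (slice g u) y = poly (slice f y) (t * y + u)" for u y
  proof -
    have "poly (slice g u) y = (\<Sum>s\<le>k. \<Sum>i\<le>s. coeff (H s) (s - i) * u ^ (s - i) * y ^ i)"
      unfolding poly_slice_by_degree[OF degg] by (intro sum.cong refl) (simp add: g)
    \<comment> \<open>reverse each inner sum, since in \<open>g\<close> the outer variable is \<open>y\<close> and not \<open>u\<close>\<close>
    also have "\<dots> = (\<Sum>s\<le>k. homog_eval s (H s) y u)"
    proof (intro sum.cong refl)
      fix s
      show "(\<Sum>i\<le>s. coeff (H s) (s - i) * u ^ (s - i) * y ^ i) = homog_eval s (H s) y u"
        unfolding homog_eval_def
        by (rule sum.reindex_bij_witness[of _ "\<lambda>i. s - i" "\<lambda>i. s - i"]) (auto simp: mult_ac)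
    qed
    also have "\<dots> = (\<Sum>s\<le>k. homog_eval s (homog_comp f s) y (t * y + u))"
      by (simp add: H_def homog_eval_shear degree_homog_comp_le)
    also have "\<dots> = poly (slice f y) (t * y + u)"
      unfolding poly_slice_by_degree[OF deg] homog_eval_def
      by (intro sum.cong refl) (simp add: coeff_homog_comp)
    finally show ?thesis .
  qed
  then have "bij_betw (\<lambda>(u, y). (y, t * y + u)) (zeros2 g) (zeros2 f)"
    by (intro bij_betw_byWitness[where f' = "\<lambda>(y, z). (z - t * y, y)"]) (auto simp: zeros2_def)
  then have card_eq: "card (zeros2 f) = card (zeros2 g)"
    by (metis bij_betw_same_card)
  obtain r where r: "r \<le> degree (lead_coeff g)" "r \<le> CARD('a)"
    "card (zeros2 g) \<le> r * CARD('a) + (CARD('a) - r) * degree g"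
    using card_zeros2_le[OF \<open>g \<noteq> 0\<close>] .
  have "r + degree g \<le> k"
    using r(1) degree_le_of_total_degree_le(2)[OF degg \<open>g \<noteq> 0\<close>] by linarith
  \<comment> \<open>the monomials of degree \<open>k\<close> in the sheared polynomial carry the coefficients of the translated top component\<close>
  have "coeff (H k) l = 0" if "l < k - degree g" for l
  proof -
    have "coeff g (k - l) = 0" using that by (intro coeff_eq_0) linarith
    then show ?thesis using g[of "k - l" l] that by simp
  qed
  then have "monom 1 (k - degree g) dvd H k"
    by (simp add: monom_1_dvd_iff')
  then obtain p where p: "H k = monom 1 (k - degree g) * p" by blast
  then have "p \<noteq> 0" using \<open>H k \<noteq> 0\<close> by auto
  then have "degree (H k) = k - degree g + degree p"
    by (simp add: p degree_mult_eq degree_monom_eq)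
  then have "degree p \<le> degree g" using degH[of k] J by linarith
  have "{x. poly (homog_comp f k) x = 0} \<subseteq> insert t ((\<lambda>x. x + t) ` {x. poly p x = 0})"
  proof
    fix x assume "x \<in> {x. poly (homog_comp f k) x = 0}"
    then have "poly (H k) (x - t) = 0" by (simp add: H_def poly_pcompose)
    then have "x = t \<or> poly p (x - t) = 0" by (auto simp: p poly_monom)
    then show "x \<in> insert t ((\<lambda>x. x + t) ` {x. poly p x = 0})"
      by (auto intro: image_eqI[where x = "x - t"])
  qed
  then have "card {x. poly (homog_comp f k) x = 0} \<le> card (insert t ((\<lambda>x. x + t) ` {x. poly p x = 0}))"
    by (intro card_mono) auto
  also have "\<dots> \<le> Suc (card ((\<lambda>x. x + t) ` {x. poly p x = 0}))"
    by (rule card_insert_le_m1) auto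
  also have "\<dots> \<le> Suc (card {x. poly p x = 0})"
    by (simp add: card_image_le)
  also have "\<dots> \<le> Suc (degree p)"
    using card_poly_roots_bound[OF \<open>p \<noteq> 0\<close>] by simp
  finally have "card {x. poly (homog_comp f k) x = 0} \<le> degree g + 1"
    using \<open>degree p \<le> degree g\<close> by simp
  then show ?thesis
    using pencil_bound[OF r(3) _ \<open>r + degree g \<le> k\<close> _ r(2) assms(2)] J card_eq
      \<open>r + degree g \<le> k\<close> by (cases "r = 0") auto
qed

section \<open>Representatives of the rational points\<close>

lemma power_card_eq_self:
  fixes x :: "'a::{field,finite}"
  shows "x ^ CARD('a) = x"
proof (cases "x = 0")
  case False
  define P where "P = (\<Prod>y\<in>-{0::'a}. y)"
  have "bij_betw ((*) x) (-{0}) (-{0})"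
    using False by (intro bij_betw_byWitness[where f' = "\<lambda>y. y / x"]) auto
  then have "P = (\<Prod>y\<in>-{0}. x * y)"
    unfolding P_def by (rule prod.reindex_bij_betw [symmetric])
  also have "\<dots> = x ^ card (-{0::'a}) * P"
    by (simp add: P_def prod.distrib)
  finally have "x ^ card (-{0::'a}) = 1"
    by (simp add: P_def)
  moreover have "CARD('a) = Suc (card (-{0::'a}))"
    by (simp add: Compl_eq_Diff_UNIV card_Suc_Diff1)
  ultimately show ?thesis by simp
qed (simp add: finite_UNIV_card_ge_0)

text \<open>The polynomial \<open>X\<^sup>q - X\<close> has at most \<open>q\<close> roots, and all elements of the finite field are roots.\<close>

lemma frobenius_fixed_iff:
  fixes x :: "'a::{field,finite} alg_closure"
  shows "x ^ CARD('a) = x \<longleftrightarrow> x \<in> range to_ac"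
proof -
  define p :: "'a alg_closure poly" where "p = monom 1 (CARD('a)) - monom 1 1"
  have "card {0, 1 :: 'a} \<le> CARD('a)" by (rule card_mono) auto
  then have "coeff p (CARD('a)) = 1" by (simp add: p_def)
  then have "p \<noteq> 0" by auto
  have "degree p \<le> CARD('a)"
    using \<open>card {0, 1 :: 'a} \<le> CARD('a)\<close>
    unfolding p_def by (intro degree_diff_le degree_monom_le order_trans[OF degree_monom_le]) auto
  then have "card {x. poly p x = 0} \<le> CARD('a)"
    using card_poly_roots_bound[OF \<open>p \<noteq> 0\<close>] by linarith
  also have "\<dots> = card (range (to_ac :: 'a \<Rightarrow> _))"
    by (simp add: card_image inj_to_ac)
  finally have "range to_ac = {x. poly p x = 0}"
    using poly_roots_finite[OF \<open>p \<noteq> 0\<close>]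
    by (intro card_seteq)
       (auto simp: p_def poly_monom power_card_eq_self simp flip: to_ac_power)
  then show ?thesis
    by (auto simp: p_def poly_monom)
qed

lemma equiv_wproj_rel: "equiv (nonzero_tuples m) (wproj_rel w m :: ((nat \<Rightarrow> 'k::field) \<times> _) set)"
proof (rule equivI)
  show "wproj_rel w m \<subseteq> nonzero_tuples m \<times> (nonzero_tuples m :: (nat \<Rightarrow> 'k) set)"
    by (auto simp: wproj_rel_def)
  show "refl_on (nonzero_tuples m) (wproj_rel w m :: ((nat \<Rightarrow> 'k) \<times> _) set)"
    by (auto simp: refl_on_def wproj_rel_def intro!: exI[of _ 1])
  show "sym (wproj_rel w m :: ((nat \<Rightarrow> 'k) \<times> _) set)"
  proof (rule symI)
    fix x y :: "nat \<Rightarrow> 'k" assume "(x, y) \<in> wproj_rel w m"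
    then obtain l where l: "l \<noteq> 0" "\<forall>i\<le>m. y i = l ^ w i * x i"
      and xy: "x \<in> nonzero_tuples m" "y \<in> nonzero_tuples m"
      by (auto simp: wproj_rel_def)
    then have "\<forall>i\<le>m. x i = inverse l ^ w i * y i" by (simp add: field_simps)
    then show "(y, x) \<in> wproj_rel w m"
      using l xy by (auto simp: wproj_rel_def intro!: exI[of _ "inverse l"])
  qed
  show "trans (wproj_rel w m :: ((nat \<Rightarrow> 'k) \<times> _) set)"
  proof (rule transI)
    fix x y z :: "nat \<Rightarrow> 'k"
    assume "(x, y) \<in> wproj_rel w m" "(y, z) \<in> wproj_rel w m"
    then obtain l l' where "l \<noteq> 0" "\<forall>i\<le>m. y i = l ^ w i * x i"
      "l' \<noteq> 0" "\<forall>i\<le>m. z i = l' ^ w i * y i"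
      and "x \<in> nonzero_tuples m" "z \<in> nonzero_tuples m"
      by (auto simp: wproj_rel_def)
    then show "(x, z) \<in> wproj_rel w m"
      by (auto simp: wproj_rel_def power_mult_distrib intro!: exI[of _ "l' * l"])
  qed
qed

lemma wproj_rel_sym: "(x, y) \<in> wproj_rel w m \<Longrightarrow> (y, x) \<in> wproj_rel w m"
  using equiv_wproj_rel by (blast elim: equivE dest: symD)

lemma wproj_rel_trans:
  "(x, y) \<in> wproj_rel w m \<Longrightarrow> (y, z) \<in> wproj_rel w m \<Longrightarrow> (x, z) \<in> wproj_rel w m"
  using equiv_wproj_rel by (blast elim: equivE dest: transD)

lemma wproj_point_eq_iff:
  assumes "x \<in> nonzero_tuples m" "y \<in> nonzero_tuples m"
  shows "wproj_point w m x = wproj_point w m y \<longleftrightarrow> (x, y) \<in> wproj_rel w m"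
  unfolding wproj_point_def using equiv_wproj_rel assms by (rule eq_equiv_class_iff)

definition frob :: "(nat \<Rightarrow> 'a::{field,finite} alg_closure) \<Rightarrow> nat \<Rightarrow> 'a alg_closure" where
  "frob x = (\<lambda>i. x i ^ CARD('a))"

lemma frob_nonzero_tuples: "x \<in> nonzero_tuples m \<Longrightarrow> frob x \<in> nonzero_tuples m"
  by (auto simp: nonzero_tuples_def frob_def finite_UNIV_card_ge_0)

text \<open>The representatives of rational points; their entries need not lie in the finite field.\<close>

definition rational_tuples :: "(nat \<Rightarrow> nat) \<Rightarrow> nat \<Rightarrow> (nat \<Rightarrow> 'a::{field,finite} alg_closure) set" where
  "rational_tuples w m = {x. (x, frob x) \<in> wproj_rel w m}"

lemma rational_tuples_nonzero: "x \<in> rational_tuples w m \<Longrightarrow> x \<in> nonzero_tuples m"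
  by (auto simp: rational_tuples_def wproj_rel_def)

lemma rational_tuples_rel:
  assumes "(x, y) \<in> wproj_rel w m" and "x \<in> rational_tuples w m"
  shows "y \<in> rational_tuples w m"
proof -
  from assms(1) obtain l where l: "l \<noteq> 0" "\<forall>i\<le>m. y i = l ^ w i * x i"
    and xy: "x \<in> nonzero_tuples m" "y \<in> nonzero_tuples m"
    by (auto simp: wproj_rel_def)
  then have "\<forall>i\<le>m. frob y i = (l ^ CARD('a)) ^ w i * frob x i"
    by (simp add: frob_def power_mult_distrib mult.commute flip: power_mult)
  then have "(frob x, frob y) \<in> wproj_rel w m"
    using l xy frob_nonzero_tuples by (auto simp: wproj_rel_def intro!: exI[of _ "l ^ CARD('a)"])
  then show ?thesis
    using assms wproj_rel_sym wproj_rel_trans unfolding rational_tuples_def by blast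
qed

lemma mpoly_eval_scale:
  assumes F: "F \<in> mpolys m" "weighted_homogeneous w d F" and y: "\<forall>i\<le>m. y i = l ^ w i * x i"
  shows "mpoly_eval F y = l ^ d * mpoly_eval F x"
  unfolding mpoly_eval_def sum_distrib_left
proof (rule sum.cong)
  fix \<alpha> assume \<alpha>: "\<alpha> \<in> Poly_Mapping.keys F"
  have "(\<Prod>i\<in>Poly_Mapping.keys \<alpha>. y i ^ Poly_Mapping.lookup \<alpha> i)
      = (\<Prod>i\<in>Poly_Mapping.keys \<alpha>. l ^ (w i * Poly_Mapping.lookup \<alpha> i) * x i ^ Poly_Mapping.lookup \<alpha> i)"
  proof (intro prod.cong refl)
    fix i assume "i \<in> Poly_Mapping.keys \<alpha>"
    then have "i \<le> m" using F(1) \<alpha> by (auto simp: mpolys_def)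
    then show "y i ^ Poly_Mapping.lookup \<alpha> i
        = l ^ (w i * Poly_Mapping.lookup \<alpha> i) * x i ^ Poly_Mapping.lookup \<alpha> i"
      using y by (simp add: power_mult_distrib power_mult)
  qed
  also have "\<dots> = l ^ d * (\<Prod>i\<in>Poly_Mapping.keys \<alpha>. x i ^ Poly_Mapping.lookup \<alpha> i)"
    using F(2) \<alpha> by (simp add: prod.distrib weighted_homogeneous_def flip: power_sum)
  finally show "to_ac (Poly_Mapping.lookup F \<alpha>) * (\<Prod>i\<in>Poly_Mapping.keys \<alpha>. y i ^ Poly_Mapping.lookup \<alpha> i)
      = l ^ d * (to_ac (Poly_Mapping.lookup F \<alpha>) * (\<Prod>i\<in>Poly_Mapping.keys \<alpha>. x i ^ Poly_Mapping.lookup \<alpha> i))"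
    by simp
qed simp

lemma mpoly_eval_rel:
  assumes "F \<in> mpolys m" "weighted_homogeneous w d F" "(x, y) \<in> wproj_rel w m"
  shows "mpoly_eval F y = 0 \<longleftrightarrow> mpoly_eval F x = 0"
proof -
  from assms(3) obtain l where "l \<noteq> 0" and l: "\<forall>i\<le>m. y i = l ^ w i * x i"
    by (auto simp: wproj_rel_def)
  then show ?thesis using mpoly_eval_scale[OF assms(1,2) l] by simp
qed

lemma V_eq_image:
  fixes F :: "'a::{field,finite} mpoly"
  assumes F: "F \<in> mpolys m" "weighted_homogeneous w d F"
  shows "V w m F = wproj_point w m ` {x \<in> rational_tuples w m. mpoly_eval F x = 0}"
    (is "_ = ?I")
proof
  show "V w m F \<subseteq> ?I"
  proof
    fix P assume P: "P \<in> V w m F"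
    then obtain x where x: "x \<in> nonzero_tuples m" "P = wproj_point w m x"
      by (auto simp: V_def wproj_rational_points_def wproj_space_def wproj_point_def quotient_def)
    have "x \<in> P"
      using x equiv_class_self[OF equiv_wproj_rel] by (auto simp: wproj_point_def)
    then have "mpoly_eval F x = 0" "wproj_point w m x = wproj_point w m (frob x)"
      using P by (auto simp: V_def wproj_rational_points_def frob_def)
    then show "P \<in> ?I"
      using x by (auto simp: rational_tuples_def wproj_point_eq_iff frob_nonzero_tuples)
  qed
  show "?I \<subseteq> V w m F"
  proof
    fix P assume "P \<in> ?I"
    then obtain x where x: "x \<in> rational_tuples w m" "mpoly_eval F x = 0" "P = wproj_point w m x"
      by blast
    then have "P \<in> wproj_space w m"
      using rational_tuples_nonzero
      by (auto simp: wproj_space_def wproj_point_def quotient_def)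
    moreover have "wproj_point w m y = wproj_point w m (frob y) \<and> mpoly_eval F y = 0" if "y \<in> P" for y
    proof -
      have xy: "(x, y) \<in> wproj_rel w m" using that x by (simp add: wproj_point_def)
      then have "y \<in> rational_tuples w m" using x rational_tuples_rel by blast
      then show ?thesis
        using rational_tuples_nonzero[of y] mpoly_eval_rel[OF F xy] x
        by (simp add: rational_tuples_def wproj_point_eq_iff frob_nonzero_tuples)
    qed
    ultimately show "P \<in> V w m F"
      by (simp add: V_def wproj_rational_points_def frob_def)
  qed
qed

text \<open>Counting zeros of a form among rational points reduces to counting them in a complete irredundant
system of representatives, because vanishing does not depend on the representative.\<close>

lemma card_V_representatives:
  fixes F :: "'a::{field,finite} mpoly"
  assumes F: "F \<in> mpolys m" "weighted_homogeneous w d F"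
    and rat: "R \<subseteq> rational_tuples w m"
    and complete: "\<And>x. x \<in> rational_tuples w m \<Longrightarrow> \<exists>r\<in>R. (x, r) \<in> wproj_rel w m"
    and unique: "\<And>r s. r \<in> R \<Longrightarrow> s \<in> R \<Longrightarrow> (r, s) \<in> wproj_rel w m \<Longrightarrow> r = s"
  shows "card (V w m F) = card {r \<in> R. mpoly_eval F r = 0}"
proof -
  have "V w m F = wproj_point w m ` {r \<in> R. mpoly_eval F r = 0}"
    unfolding V_eq_image[OF F]
  proof (intro equalityI subsetI)
    fix P assume "P \<in> wproj_point w m ` {x \<in> rational_tuples w m. mpoly_eval F x = 0}"
    then obtain x where x: "x \<in> rational_tuples w m" "mpoly_eval F x = 0" "P = wproj_point w m x"
      by blast
    with complete obtain r where r: "r \<in> R" "(x, r) \<in> wproj_rel w m" by blast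
    then have "P = wproj_point w m r"
      using x(3) by (simp add: wproj_point_def equiv_class_eq[OF equiv_wproj_rel])
    then show "P \<in> wproj_point w m ` {r \<in> R. mpoly_eval F r = 0}"
      using r x(2) mpoly_eval_rel[OF F r(2)] by blast
  qed (use rat in blast)
  moreover have "inj_on (wproj_point w m) {r \<in> R. mpoly_eval F r = 0}"
  proof (rule inj_onI)
    fix r s assume "r \<in> {r \<in> R. mpoly_eval F r = 0}" "s \<in> {r \<in> R. mpoly_eval F r = 0}"
      and eq: "wproj_point w m r = wproj_point w m s"
    then have "r \<in> R" "s \<in> R" by auto
    then have "r \<in> nonzero_tuples m" "s \<in> nonzero_tuples m"
      using rat rational_tuples_nonzero by blast+
    then show "r = s" using eq unique[OF \<open>r \<in> R\<close> \<open>s \<in> R\<close>] by (simp add: wproj_point_eq_iff)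
  qed
  ultimately show ?thesis by (simp add: card_image)
qed

text \<open>With \<open>z = 0\<close> this also serves as the notation for the tuples of the weighted projective line.\<close>

definition tup3 :: "'k \<Rightarrow> 'k \<Rightarrow> 'k \<Rightarrow> nat \<Rightarrow> 'k::zero" where
  "tup3 x y z = (\<lambda>i. if i = 0 then x else if i = 1 then y else if i = 2 then z else 0)"

lemma tup3_simps [simp]:
  "tup3 x y z 0 = x" "tup3 x y z (Suc 0) = y" "tup3 x y z 2 = z" "2 < i \<Longrightarrow> tup3 x y z i = 0"
  by (auto simp: tup3_def)

lemma tup3_eq_iff [simp]: "tup3 x y z = tup3 x' y' z' \<longleftrightarrow> x = x' \<and> y = y' \<and> z = z'"
  by (metis tup3_simps(1-3))

lemma le_2_iff: "i \<le> 2 \<longleftrightarrow> i = 0 \<or> i = Suc 0 \<or> i = (2::nat)"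
  by auto

lemma le_1_iff: "i \<le> Suc 0 \<longleftrightarrow> i = 0 \<or> i = Suc 0"
  by auto

lemma nonzero_tuples_2:
  "x \<in> nonzero_tuples 2 \<longleftrightarrow> (\<exists>a b c. x = tup3 a b c \<and> (a \<noteq> 0 \<or> b \<noteq> 0 \<or> c \<noteq> 0))"
proof
  assume *: "x \<in> nonzero_tuples 2"
  then have "x = tup3 (x 0) (x 1) (x 2)"
    by (auto simp: nonzero_tuples_def tup3_def fun_eq_iff)
  with * show "\<exists>a b c. x = tup3 a b c \<and> (a \<noteq> 0 \<or> b \<noteq> 0 \<or> c \<noteq> 0)"
    by (auto simp: nonzero_tuples_def le_2_iff)
qed (auto simp: nonzero_tuples_def le_2_iff)

lemma nonzero_tuples_1:
  "x \<in> nonzero_tuples (Suc 0) \<longleftrightarrow> (\<exists>a b. x = tup3 a b 0 \<and> (a \<noteq> 0 \<or> b \<noteq> 0))"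
proof
  assume *: "x \<in> nonzero_tuples (Suc 0)"
  then have "x = tup3 (x 0) (x 1) 0"
    by (auto simp: nonzero_tuples_def tup3_def fun_eq_iff)
  with * show "\<exists>a b. x = tup3 a b 0 \<and> (a \<noteq> 0 \<or> b \<noteq> 0)"
    by (auto simp: nonzero_tuples_def le_1_iff)
next
  assume "\<exists>a b. x = tup3 a b 0 \<and> (a \<noteq> 0 \<or> b \<noteq> 0)"
  then show "x \<in> nonzero_tuples (Suc 0)"
    by (auto simp: nonzero_tuples_def le_1_iff tup3_def)
qed

lemma wproj_rel_2:
  "(tup3 a b c, tup3 a' b' c') \<in> wproj_rel w 2 \<longleftrightarrow>
     (a \<noteq> 0 \<or> b \<noteq> 0 \<or> c \<noteq> 0) \<and>
     (\<exists>l. l \<noteq> 0 \<and> a' = l ^ w 0 * a \<and> b' = l ^ w 1 * b \<and> c' = l ^ w 2 * c)"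
  by (auto simp: wproj_rel_def nonzero_tuples_2 le_2_iff)

lemma wproj_rel_1:
  "(tup3 a b 0, tup3 a' b' 0) \<in> wproj_rel w (Suc 0) \<longleftrightarrow>
     (a \<noteq> 0 \<or> b \<noteq> 0) \<and> (\<exists>l. l \<noteq> 0 \<and> a' = l ^ w 0 * a \<and> b' = l ^ w 1 * b)"
  by (auto simp: wproj_rel_def nonzero_tuples_1 le_1_iff)

lemma frob_tup3: "frob (tup3 a b c :: nat \<Rightarrow> 'a::{field,finite} alg_closure)
   = tup3 (a ^ CARD('a)) (b ^ CARD('a)) (c ^ CARD('a))"
  by (auto simp: frob_def tup3_def fun_eq_iff finite_UNIV_card_ge_0)

lemma ex_root_scale:
  fixes x :: "'k::alg_closed_field"
  assumes "x \<noteq> 0" "n > 0"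
  shows "\<exists>l. l \<noteq> 0 \<and> l ^ n * x = 1"
proof -
  obtain l where "l ^ n = inverse x" using nth_root_exists[OF assms(2)] by blast
  then show ?thesis using assms by (intro exI[of _ l]) (auto simp: power_0_left)
qed

text \<open>With \<open>g = gcd(a\<^sub>1, a\<^sub>2)\<close>, \<open>a\<^sub>1 = ga\<close> and \<open>a\<^sub>2 = gb\<close>, the points \<open>(0:1:z)\<close> and \<open>(0:1:z')\<close> agree iff
\<open>z' = l\<^sup>g\<^sup>bz\<close> for some \<open>l\<close> whose power \<open>l\<^sup>g\<close> is an \<open>a\<close>-th root of unity. As \<open>a\<close> and \<open>b\<close> are coprime, these
factors are exactly the \<open>a\<close>-th roots of unity, so \<open>z\<^sup>a\<close> is a complete invariant. This works over an
algebraically closed field of any characteristic, including one that divides \<open>a\<close> or \<open>g\<close>.\<close>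

lemma infinity_rel_iff:
  fixes z z' :: "'k::alg_closed_field"
  assumes "0 < w 1" and "0 < w 2"
  shows "(tup3 0 1 z, tup3 0 1 z') \<in> wproj_rel w 2 \<longleftrightarrow>
    z ^ (w 1 div gcd (w 1) (w 2)) = z' ^ (w 1 div gcd (w 1) (w 2))"
proof -
  define g where "g = gcd (w 1) (w 2)"
  define a where "a = w 1 div g"
  define b where "b = w 2 div g"
  have "g > 0" using assms by (simp add: g_def)
  have ab: "w 1 = g * a" "w 2 = g * b" by (auto simp: g_def a_def b_def)
  have "coprime b a"
    using div_gcd_coprime[of "w 1" "w 2"] assms
    by (simp add: a_def b_def g_def coprime_commute)
  have "a > 0" using assms ab by auto
  have "(tup3 0 1 z, tup3 0 1 z') \<in> wproj_rel w 2 \<longleftrightarrow> (\<exists>l. l \<noteq> 0 \<and> l ^ w 1 = 1 \<and> z' = l ^ w 2 * z)"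
    unfolding wproj_rel_2 by auto
  also have "\<dots> \<longleftrightarrow> z ^ a = z' ^ a"
  proof
    assume "\<exists>l. l \<noteq> 0 \<and> l ^ w 1 = 1 \<and> z' = l ^ w 2 * z"
    then obtain l where l: "l ^ w 1 = 1" "z' = l ^ w 2 * z" by blast
    have "w 2 * a = w 1 * b" by (simp only: ab mult_ac)
    then have "z' ^ a = (l ^ w 1) ^ b * z ^ a"
      by (simp only: l(2) power_mult_distrib flip: power_mult)
    then show "z ^ a = z' ^ a" by (simp only: l(1) power_one mult_1)
  next
    assume eq: "z ^ a = z' ^ a"
    show "\<exists>l. l \<noteq> 0 \<and> l ^ w 1 = 1 \<and> z' = l ^ w 2 * z"
    proof (cases "z = 0")
      case True
      then have "z' = 0" using eq \<open>a > 0\<close> by (metis power_0_left power_eq_0_iff not_gr_zero)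
      then show ?thesis using True by (intro exI[of _ 1]) auto
    next
      case False
      define e where "e = z' / z"
      have e: "e ^ a = 1" using False by (simp add: e_def power_divide flip: eq)
      \<comment> \<open>the factor \<open>e\<close> is an \<open>a\<close>-th root of unity; if \<open>u\<close> inverts \<open>b\<close> modulo \<open>a\<close>, it is the \<open>b\<close>-th power of \<open>e\<^sup>u\<close>\<close>
      obtain u v where uv: "b * u = a * v + 1"
        using bezout_nat[of b a] \<open>coprime b a\<close> assms ab by (auto simp: coprime_iff_gcd_eq_1)
      obtain l where l: "l ^ g = e ^ u" using nth_root_exists[OF \<open>g > 0\<close>] by blast
      have "l ^ w 1 = (l ^ g) ^ a" unfolding ab(1) by (rule power_mult)
      also have "\<dots> = (e ^ a) ^ u" unfolding l by (simp add: mult.commute flip: power_mult)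
      finally have 1: "l ^ w 1 = 1" by (simp add: e)
      have "l ^ w 2 = (l ^ g) ^ b" unfolding ab(2) by (rule power_mult)
      also have "\<dots> = e ^ (b * u)" unfolding l by (simp add: mult.commute flip: power_mult)
      also have "\<dots> = e" by (simp add: uv power_add power_mult e)
      finally have "z' = l ^ w 2 * z" using False by (simp add: e_def)
      moreover have "l \<noteq> 0"
      proof
        assume "l = 0"
        then show False using 1 assms(1) by (simp add: power_0_left)
      qed
      ultimately show ?thesis using 1 by blast
    qed
  qed
  finally show ?thesis by (simp add: a_def g_def)
qed

text \<open>By \<open>infinity_rel_iff\<close> the point \<open>(0:1:z)\<close> is rational iff the invariant \<open>\<tau> = z\<^sup>e\<close> is fixed by the
Frobenius map, i.e. lies in the finite field. The function \<open>\<rho>\<close> selects one \<open>z\<close> for each \<open>\<tau>\<close>; it may take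
values outside the finite field.\<close>

lemma card_V_2:
  fixes F :: "'a::{field,finite} mpoly"
  assumes w: "w 0 = 1" "0 < w 1" "0 < w 2"
    and F: "F \<in> mpolys 2" "weighted_homogeneous w d F"
    and \<rho>: "\<And>\<tau>. \<rho> \<tau> ^ (w 1 div gcd (w 1) (w 2)) = to_ac \<tau>"
  shows "card (V w 2 F) = card {(y, z). mpoly_eval F (tup3 1 (to_ac y) (to_ac z)) = 0}
    + card {\<tau>. mpoly_eval F (tup3 0 1 (\<rho> \<tau>)) = 0}
    + (if mpoly_eval F (tup3 0 0 1) = 0 then 1 else 0)"
proof -
  define e where "e = w 1 div gcd (w 1) (w 2)"
  define R1 where "R1 = range (\<lambda>(y, z). tup3 1 (to_ac y) (to_ac z :: 'a alg_closure))"
  define R2 where "R2 = range (\<lambda>\<tau>. tup3 0 1 (\<rho> \<tau>))"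
  define R where "R = insert (tup3 0 0 1) (R1 \<union> R2)"
  note rel_inf = infinity_rel_iff[OF w(2,3), folded e_def]
  have rat_inf: "tup3 0 1 z \<in> rational_tuples w 2 \<longleftrightarrow> z ^ e \<in> range to_ac" for z :: "'a alg_closure"
  proof -
    have "tup3 0 1 z \<in> rational_tuples w 2 \<longleftrightarrow> (tup3 0 1 z, tup3 0 1 (z ^ CARD('a))) \<in> wproj_rel w 2"
      by (simp add: rational_tuples_def frob_tup3 power_0_left finite_UNIV_card_ge_0)
    also have "\<dots> \<longleftrightarrow> (z ^ e) ^ CARD('a) = z ^ e"
      unfolding rel_inf by (subst eq_commute) (simp add: mult.commute flip: power_mult)
    finally show ?thesis by (simp add: frobenius_fixed_iff)
  qed
  have "card (V w 2 F) = card {r \<in> R. mpoly_eval F r = 0}"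
  proof (rule card_V_representatives[OF F])
    show "R \<subseteq> rational_tuples w 2"
      using \<rho> unfolding R_def R1_def R2_def
      by (auto simp: rat_inf e_def)
         (auto simp: rational_tuples_def frob_tup3 power_card_eq_self wproj_rel_2 power_0_left
            finite_UNIV_card_ge_0 intro!: exI[of _ 1] simp flip: to_ac_power)
  next
    fix x :: "nat \<Rightarrow> 'a alg_closure" assume x: "x \<in> rational_tuples w 2"
    have via: "\<exists>r\<in>R. (x, r) \<in> wproj_rel w 2"
      if "(x, s) \<in> wproj_rel w 2" "s \<in> rational_tuples w 2 \<Longrightarrow> \<exists>r\<in>R. (s, r) \<in> wproj_rel w 2" for s
      using that rational_tuples_rel[OF that(1) x] wproj_rel_trans by blast
    obtain a b c where abc: "x = tup3 a b c" "a \<noteq> 0 \<or> b \<noteq> 0 \<or> c \<noteq> 0"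
      using rational_tuples_nonzero[OF x] by (auto simp: nonzero_tuples_2)
    consider "a \<noteq> 0" | "a = 0" "b \<noteq> 0" | "a = 0" "b = 0" "c \<noteq> 0" using abc by blast
    then show "\<exists>r\<in>R. (x, r) \<in> wproj_rel w 2"
    proof cases
      case 1
      define y z where "y = inverse a ^ w 1 * b" and "z = inverse a ^ w 2 * c"
      have "(x, tup3 1 y z) \<in> wproj_rel w 2"
        using 1 by (auto simp: abc wproj_rel_2 y_def z_def w intro!: exI[of _ "inverse a"])
      then have r: "tup3 1 y z \<in> rational_tuples w 2" using x rational_tuples_rel by blast
      then have "y ^ CARD('a) = y" "z ^ CARD('a) = z"
        by (auto simp: rational_tuples_def frob_tup3 wproj_rel_2 w)
      then have "tup3 1 y z \<in> R" by (auto simp: frobenius_fixed_iff R_def R1_def)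
      then show ?thesis using \<open>(x, tup3 1 y z) \<in> wproj_rel w 2\<close> by blast
    next
      case 2
      obtain l where l: "l \<noteq> 0" "l ^ w 1 * b = 1" using ex_root_scale 2 w by metis
      show ?thesis
      proof (rule via)
        show "(x, tup3 0 1 (l ^ w 2 * c)) \<in> wproj_rel w 2"
          using 2 l by (auto simp: abc wproj_rel_2 intro!: exI[of _ l])
        assume "tup3 0 1 (l ^ w 2 * c) \<in> rational_tuples w 2"
        then obtain \<tau> where "(l ^ w 2 * c) ^ e = to_ac \<tau>" by (auto simp: rat_inf)
        then have "(tup3 0 1 (l ^ w 2 * c), tup3 0 1 (\<rho> \<tau>)) \<in> wproj_rel w 2"
          by (simp add: rel_inf \<rho>[folded e_def])
        then show "\<exists>r\<in>R. (tup3 0 1 (l ^ w 2 * c), r) \<in> wproj_rel w 2"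
          by (auto simp: R_def R2_def)
      qed
    next
      case 3
      obtain l where "l \<noteq> 0" "l ^ w 2 * c = 1" using ex_root_scale 3 w by metis
      then have "(x, tup3 0 0 1) \<in> wproj_rel w 2"
        using 3 by (auto simp: abc wproj_rel_2 intro!: exI[of _ l])
      then show ?thesis by (auto simp: R_def)
    qed
  next
    fix r s assume "r \<in> R" "s \<in> R" and rs: "(r, s) \<in> wproj_rel w 2"
    show "r = s"
    proof (cases "r \<in> R2 \<and> s \<in> R2")
      case True
      then obtain \<tau> \<tau>' where "r = tup3 0 1 (\<rho> \<tau>)" "s = tup3 0 1 (\<rho> \<tau>')"
        by (auto simp: R2_def)
      then show ?thesis using rs by (simp add: rel_inf \<rho>[folded e_def])
    next
      case False
      then show ?thesis
        using \<open>r \<in> R\<close> \<open>s \<in> R\<close> rs by (auto simp: R_def R1_def R2_def wproj_rel_2 w)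
    qed
  qed
  also have "{r \<in> R. mpoly_eval F r = 0} =
      (\<lambda>(y, z). tup3 1 (to_ac y) (to_ac z)) ` {(y, z). mpoly_eval F (tup3 1 (to_ac y) (to_ac z)) = 0}
    \<union> (\<lambda>\<tau>. tup3 0 1 (\<rho> \<tau>)) ` {\<tau>. mpoly_eval F (tup3 0 1 (\<rho> \<tau>)) = 0}
    \<union> (if mpoly_eval F (tup3 0 0 1) = 0 then {tup3 0 0 1} else {})" (is "_ = ?A \<union> ?B \<union> ?C")
    by (auto simp: R_def R1_def R2_def)
  also have "card \<dots> = card ?A + card ?B + card ?C"
    by (subst card_Un_disjoint; (subst card_Un_disjoint)?) auto
  also have "card ?A = card {(y, z). mpoly_eval F (tup3 1 (to_ac y) (to_ac z)) = 0}"
    by (rule card_image) (auto simp: inj_on_def)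
  also have "card ?B = card {\<tau>. mpoly_eval F (tup3 0 1 (\<rho> \<tau>)) = 0}"
    by (rule card_image, rule inj_onI) (metis \<rho> to_ac_eq_iff tup3_eq_iff)
  finally show ?thesis by simp
qed

lemma card_V_1:
  fixes F :: "'a::{field,finite} mpoly"
  assumes w: "w 0 = 1" "0 < w 1"
    and F: "F \<in> mpolys 1" "weighted_homogeneous w d F"
  shows "card (V w 1 F) = card {y. mpoly_eval F (tup3 1 (to_ac y) 0) = 0}
    + (if mpoly_eval F (tup3 0 1 0) = 0 then 1 else 0)"
proof -
  define R where "R = insert (tup3 0 1 0) (range (\<lambda>y. tup3 1 (to_ac y) (0 :: 'a alg_closure)))"
  have "card (V w 1 F) = card {r \<in> R. mpoly_eval F r = 0}"
  proof (rule card_V_representatives[OF F])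
    show "R \<subseteq> rational_tuples w 1"
      unfolding R_def
      by (auto simp: rational_tuples_def frob_tup3 power_card_eq_self wproj_rel_1 power_0_left
            finite_UNIV_card_ge_0 intro!: exI[of _ 1] simp flip: to_ac_power)
  next
    fix x :: "nat \<Rightarrow> 'a alg_closure" assume x: "x \<in> rational_tuples w 1"
    obtain a b where ab: "x = tup3 a b 0" "a \<noteq> 0 \<or> b \<noteq> 0"
      using rational_tuples_nonzero[OF x] by (auto simp: nonzero_tuples_1)
    show "\<exists>r\<in>R. (x, r) \<in> wproj_rel w 1"
    proof (cases "a = 0")
      case False
      define y where "y = inverse a ^ w 1 * b"
      have xy: "(x, tup3 1 y 0) \<in> wproj_rel w 1"
        using False by (auto simp: ab wproj_rel_1 y_def w intro!: exI[of _ "inverse a"])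
      then have "tup3 1 y 0 \<in> rational_tuples w 1" using x rational_tuples_rel by blast
      then have "y ^ CARD('a) = y"
        by (auto simp: rational_tuples_def frob_tup3 wproj_rel_1 power_0_left finite_UNIV_card_ge_0 w)
      then have "tup3 1 y 0 \<in> R" by (auto simp: frobenius_fixed_iff R_def)
      then show ?thesis using xy by blast
    next
      case True
      then obtain l where "l \<noteq> 0" "l ^ w 1 * b = 1" using ex_root_scale ab(2) w by metis
      then have "(x, tup3 0 1 0) \<in> wproj_rel w 1"
        using True ab(2) by (auto simp: ab(1) wproj_rel_1 intro!: exI[of _ l])
      then show ?thesis by (auto simp: R_def)
    qed
  next
    fix r s assume "r \<in> R" "s \<in> R" "(r, s) \<in> wproj_rel w 1"
    then show "r = s" by (auto simp: R_def wproj_rel_1 w)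
  qed
  also have "{r \<in> R. mpoly_eval F r = 0} =
      (\<lambda>y. tup3 1 (to_ac y) 0) ` {y. mpoly_eval F (tup3 1 (to_ac y) 0) = 0}
    \<union> (if mpoly_eval F (tup3 0 1 0) = 0 then {tup3 0 1 0} else {})" (is "_ = ?A \<union> ?C")
    by (auto simp: R_def)
  also have "card \<dots> = card ?A + card ?C"
    by (subst card_Un_disjoint) auto
  also have "card ?A = card {y. mpoly_eval F (tup3 1 (to_ac y) 0) = 0}"
    by (rule card_image) (auto simp: inj_on_def)
  finally show ?thesis by simp
qed

section \<open>Weighted forms in affine coordinates and at infinity\<close>

lemma mpolys_mono: "m \<le> n \<Longrightarrow> mpolys m \<subseteq> mpolys n"
  by (force simp: mpolys_def)

lemma weighted_degree_3:
  assumes "F \<in> mpolys 2" "weighted_homogeneous w d F" "\<alpha> \<in> Poly_Mapping.keys F"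
  shows "w 0 * Poly_Mapping.lookup \<alpha> 0 + w 1 * Poly_Mapping.lookup \<alpha> 1
    + w 2 * Poly_Mapping.lookup \<alpha> 2 = d"
proof -
  have "(\<Sum>i\<in>Poly_Mapping.keys \<alpha>. w i * Poly_Mapping.lookup \<alpha> i)
      = (\<Sum>i\<le>2. w i * Poly_Mapping.lookup \<alpha> i)"
    using assms by (intro sum.mono_neutral_left) (auto simp: mpolys_def in_keys_iff)
  then show ?thesis
    using assms by (simp add: weighted_homogeneous_def eval_nat_numeral)
qed

lemma exponents_eqI:
  assumes "F \<in> mpolys 2" "\<alpha> \<in> Poly_Mapping.keys F" "\<beta> \<in> Poly_Mapping.keys F"
    and "Poly_Mapping.lookup \<alpha> 0 = Poly_Mapping.lookup \<beta> 0"
    and "Poly_Mapping.lookup \<alpha> 1 = Poly_Mapping.lookup \<beta> 1"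
    and "Poly_Mapping.lookup \<alpha> 2 = Poly_Mapping.lookup \<beta> 2"
  shows "\<alpha> = \<beta>"
proof (rule poly_mapping_eqI)
  fix i
  have "Poly_Mapping.lookup \<gamma> i = 0" if "\<gamma> \<in> Poly_Mapping.keys F" "\<not> i \<le> 2" for \<gamma>
    using that assms(1) by (auto simp: mpolys_def in_keys_iff subset_iff)
  then show "Poly_Mapping.lookup \<alpha> i = Poly_Mapping.lookup \<beta> i"
    using assms by (cases "i \<le> 2") (auto simp: le_2_iff)
qed

lemma mpoly_eval_tup3:
  assumes "F \<in> mpolys 2"
  shows "mpoly_eval F (tup3 x y z) = (\<Sum>\<alpha>\<in>Poly_Mapping.keys F. to_ac (Poly_Mapping.lookup F \<alpha>) *
     (x ^ Poly_Mapping.lookup \<alpha> 0 * y ^ Poly_Mapping.lookup \<alpha> 1 * z ^ Poly_Mapping.lookup \<alpha> 2))"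
  unfolding mpoly_eval_def
proof (intro sum.cong refl arg_cong2[where f = "(*)"])
  fix \<alpha> assume "\<alpha> \<in> Poly_Mapping.keys F"
  then have "(\<Prod>i\<in>Poly_Mapping.keys \<alpha>. tup3 x y z i ^ Poly_Mapping.lookup \<alpha> i)
      = (\<Prod>i\<le>2. tup3 x y z i ^ Poly_Mapping.lookup \<alpha> i)"
    using assms by (intro prod.mono_neutral_left) (auto simp: mpolys_def in_keys_iff)
  then show "(\<Prod>i\<in>Poly_Mapping.keys \<alpha>. tup3 x y z i ^ Poly_Mapping.lookup \<alpha> i)
      = x ^ Poly_Mapping.lookup \<alpha> 0 * y ^ Poly_Mapping.lookup \<alpha> 1 * z ^ Poly_Mapping.lookup \<alpha> 2"
    by (simp add: eval_nat_numeral tup3_def)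
qed

text \<open>The polynomial \<open>F(1,y,z)\<close>. For a form of known degree no information is lost, as the exponent of
\<open>X\<^sub>0\<close> is determined by the other two (\<open>coeff_dehom_key\<close>).\<close>

definition dehom :: "'a::field mpoly \<Rightarrow> 'a poly poly" where
  "dehom F = (\<Sum>\<alpha>\<in>Poly_Mapping.keys F.
     monom (monom (Poly_Mapping.lookup F \<alpha>) (Poly_Mapping.lookup \<alpha> 1)) (Poly_Mapping.lookup \<alpha> 2))"

lemma coeff_dehom:
  "coeff (coeff (dehom F) j) i = (\<Sum>\<alpha>\<in>Poly_Mapping.keys F.
     if Poly_Mapping.lookup \<alpha> 1 = i \<and> Poly_Mapping.lookup \<alpha> 2 = j then Poly_Mapping.lookup F \<alpha> else 0)"
  by (auto simp: dehom_def coeff_sum intro!: sum.cong)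

lemma coeff_dehom_key:
  assumes "F \<in> mpolys 2" "weighted_homogeneous w d F" "0 < w 0" "\<alpha> \<in> Poly_Mapping.keys F"
  shows "coeff (coeff (dehom F) (Poly_Mapping.lookup \<alpha> 2)) (Poly_Mapping.lookup \<alpha> 1)
    = Poly_Mapping.lookup F \<alpha>"
proof -
  have eq: "\<beta> = \<alpha>" if "\<beta> \<in> Poly_Mapping.keys F"
    "Poly_Mapping.lookup \<beta> 1 = Poly_Mapping.lookup \<alpha> 1"
    "Poly_Mapping.lookup \<beta> 2 = Poly_Mapping.lookup \<alpha> 2" for \<beta>
    using that weighted_degree_3[OF assms(1,2) that(1)] weighted_degree_3[OF assms(1,2,4)] assms
    by (intro exponents_eqI[OF assms(1)]) auto
  have "coeff (coeff (dehom F) (Poly_Mapping.lookup \<alpha> 2)) (Poly_Mapping.lookup \<alpha> 1)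
      = (\<Sum>\<beta>\<in>Poly_Mapping.keys F. if \<beta> = \<alpha> then Poly_Mapping.lookup F \<beta> else 0)"
    unfolding coeff_dehom using eq by (intro sum.cong refl) auto
  then show ?thesis using assms(4) by simp
qed

lemma coeff_dehom_nonzeroE:
  assumes "coeff (coeff (dehom F) j) i \<noteq> 0"
  obtains \<alpha> where "\<alpha> \<in> Poly_Mapping.keys F"
    "Poly_Mapping.lookup \<alpha> 1 = i" "Poly_Mapping.lookup \<alpha> 2 = j"
proof -
  from assms obtain \<alpha> where "\<alpha> \<in> Poly_Mapping.keys F"
    "(if Poly_Mapping.lookup \<alpha> 1 = i \<and> Poly_Mapping.lookup \<alpha> 2 = j then Poly_Mapping.lookup F \<alpha> else 0) \<noteq> 0"
    unfolding coeff_dehom by (rule sum.not_neutral_contains_not_neutral)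
  then show ?thesis by (intro that[of \<alpha>]) (auto split: if_splits)
qed

lemma slice_sum: "slice (\<Sum>i\<in>A. f i) y = (\<Sum>i\<in>A. slice (f i) y)"
  by (rule poly_eqI) (simp add: coeff_sum poly_sum)

lemma slice_monom: "slice (monom e j) y = monom (poly e y) j"
  by (rule poly_eqI) simp

lemma mpoly_eval_affine:
  assumes "F \<in> mpolys 2"
  shows "mpoly_eval F (tup3 1 (to_ac y) (to_ac z)) = to_ac (poly (slice (dehom F) y) z)"
  using assms
  by (simp add: mpoly_eval_tup3 dehom_def slice_sum slice_monom poly_sum poly_monom to_ac_sum mult_ac)

text \<open>On the line \<open>x\<^sub>0 = 0\<close> every exponent of \<open>X\<^sub>2\<close> in a form whose degree is a multiple of \<open>a\<^sub>1\<close> is divisible by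
\<open>e = a\<^sub>1 / gcd(a\<^sub>1, a\<^sub>2)\<close>. Hence \<open>F(0,1,z)\<close> is a polynomial in the invariant \<open>\<tau> = z\<^sup>e\<close>.\<close>

definition infinity_poly :: "nat \<Rightarrow> 'a::field mpoly \<Rightarrow> 'a poly" where
  "infinity_poly e F = (\<Sum>\<alpha>\<in>{\<alpha> \<in> Poly_Mapping.keys F. Poly_Mapping.lookup \<alpha> 0 = 0}.
     monom (Poly_Mapping.lookup F \<alpha>) (Poly_Mapping.lookup \<alpha> 2 div e))"

lemma mpoly_eval_infinity:
  assumes F: "F \<in> mpolys 2"
    and e: "\<And>\<alpha>. \<alpha> \<in> Poly_Mapping.keys F \<Longrightarrow> Poly_Mapping.lookup \<alpha> 0 = 0 \<Longrightarrow> e dvd Poly_Mapping.lookup \<alpha> 2"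
    and z: "z ^ e = to_ac \<tau>"
  shows "mpoly_eval F (tup3 0 1 z) = to_ac (poly (infinity_poly e F) \<tau>)"
proof -
  have "mpoly_eval F (tup3 0 1 z) =
      (\<Sum>\<alpha>\<in>Poly_Mapping.keys F. if Poly_Mapping.lookup \<alpha> 0 = 0
         then to_ac (Poly_Mapping.lookup F \<alpha>) * z ^ Poly_Mapping.lookup \<alpha> 2 else 0)"
    unfolding mpoly_eval_tup3[OF F] by (intro sum.cong refl) (auto simp: power_0_left)
  also have "\<dots> = (\<Sum>\<alpha>\<in>{\<alpha> \<in> Poly_Mapping.keys F. Poly_Mapping.lookup \<alpha> 0 = 0}.
      to_ac (Poly_Mapping.lookup F \<alpha>) * z ^ Poly_Mapping.lookup \<alpha> 2)"
    by (simp add: sum.inter_filter)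
  also have "\<dots> = (\<Sum>\<alpha>\<in>{\<alpha> \<in> Poly_Mapping.keys F. Poly_Mapping.lookup \<alpha> 0 = 0}.
      to_ac (Poly_Mapping.lookup F \<alpha> * \<tau> ^ (Poly_Mapping.lookup \<alpha> 2 div e)))"
  proof (intro sum.cong refl)
    fix \<alpha> assume "\<alpha> \<in> {\<alpha> \<in> Poly_Mapping.keys F. Poly_Mapping.lookup \<alpha> 0 = 0}"
    then have "z ^ Poly_Mapping.lookup \<alpha> 2 = (z ^ e) ^ (Poly_Mapping.lookup \<alpha> 2 div e)"
      using e by (simp flip: power_mult)
    then show "to_ac (Poly_Mapping.lookup F \<alpha>) * z ^ Poly_Mapping.lookup \<alpha> 2
        = to_ac (Poly_Mapping.lookup F \<alpha> * \<tau> ^ (Poly_Mapping.lookup \<alpha> 2 div e))"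
      by (simp add: z)
  qed
  finally show ?thesis
    by (simp add: infinity_poly_def poly_sum poly_monom to_ac_sum)
qed

text \<open>There is no cancellation: among the monomials without \<open>X\<^sub>0\<close>, the exponent of \<open>X\<^sub>2\<close> determines that
of \<open>X\<^sub>1\<close> by the degree.\<close>

lemma coeff_infinity_poly_key:
  assumes F: "F \<in> mpolys 2" "weighted_homogeneous w d F" and "0 < w 1"
    and e: "\<And>\<alpha>. \<alpha> \<in> Poly_Mapping.keys F \<Longrightarrow> Poly_Mapping.lookup \<alpha> 0 = 0 \<Longrightarrow> e dvd Poly_Mapping.lookup \<alpha> 2"
    and \<alpha>: "\<alpha> \<in> Poly_Mapping.keys F" "Poly_Mapping.lookup \<alpha> 0 = 0"
  shows "coeff (infinity_poly e F) (Poly_Mapping.lookup \<alpha> 2 div e) = Poly_Mapping.lookup F \<alpha>"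
proof -
  define K where "K = {\<alpha> \<in> Poly_Mapping.keys F. Poly_Mapping.lookup \<alpha> 0 = 0}"
  have eq: "\<beta> = \<alpha>" if "\<beta> \<in> K" "Poly_Mapping.lookup \<beta> 2 div e = Poly_Mapping.lookup \<alpha> 2 div e" for \<beta>
  proof (rule exponents_eqI[OF F(1) _ \<alpha>(1)])
    show \<beta>: "\<beta> \<in> Poly_Mapping.keys F" "Poly_Mapping.lookup \<beta> 0 = Poly_Mapping.lookup \<alpha> 0"
      using that \<alpha> by (auto simp: K_def)
    show 2: "Poly_Mapping.lookup \<beta> 2 = Poly_Mapping.lookup \<alpha> 2"
      using that(2) e[OF \<alpha>] e[OF \<beta>(1)] \<beta>(2) \<alpha>(2) by (auto intro: dvd_div_eq_cancel)
    have "w 1 * Poly_Mapping.lookup \<beta> 1 = w 1 * Poly_Mapping.lookup \<alpha> 1"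
      using weighted_degree_3[OF F \<beta>(1), unfolded 2 \<beta>(2)] weighted_degree_3[OF F \<alpha>(1)]
      by linarith
    then show "Poly_Mapping.lookup \<beta> 1 = Poly_Mapping.lookup \<alpha> 1"
      using \<open>0 < w 1\<close> by simp
  qed
  have "coeff (infinity_poly e F) (Poly_Mapping.lookup \<alpha> 2 div e)
      = (\<Sum>\<beta>\<in>K. if \<beta> = \<alpha> then Poly_Mapping.lookup F \<beta> else 0)"
    unfolding infinity_poly_def K_def[symmetric] coeff_sum
    using eq by (intro sum.cong refl) auto
  then show ?thesis using \<alpha> by (simp add: K_def)
qed

text \<open>Only powers of \<open>X\<^sub>2\<close> survive at \<open>(0:0:1)\<close>, and the degree allows only one of them, so there is no
cancellation.\<close>

lemma mpoly_eval_001_nonzero: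
  assumes F: "F \<in> mpolys 2" "weighted_homogeneous w d F" and "0 < w 2"
    and \<alpha>: "\<alpha> \<in> Poly_Mapping.keys F" "Poly_Mapping.lookup \<alpha> 0 = 0" "Poly_Mapping.lookup \<alpha> 1 = 0"
  shows "mpoly_eval F (tup3 0 0 1) \<noteq> 0"
proof -
  have eq: "\<beta> = \<alpha>" if "\<beta> \<in> Poly_Mapping.keys F"
    "Poly_Mapping.lookup \<beta> 0 = 0" "Poly_Mapping.lookup \<beta> 1 = 0" for \<beta>
  proof (rule exponents_eqI[OF F(1) that(1) \<alpha>(1)])
    have "w 2 * Poly_Mapping.lookup \<beta> 2 = w 2 * Poly_Mapping.lookup \<alpha> 2"
      using weighted_degree_3[OF F that(1)] weighted_degree_3[OF F \<alpha>(1)] that(2,3) \<alpha>(2,3) by simp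
    then show "Poly_Mapping.lookup \<beta> 2 = Poly_Mapping.lookup \<alpha> 2"
      using \<open>0 < w 2\<close> by simp
  qed (simp_all only: that \<alpha>)
  have "mpoly_eval F (tup3 0 0 1)
      = (\<Sum>\<beta>\<in>Poly_Mapping.keys F. if \<beta> = \<alpha> then to_ac (Poly_Mapping.lookup F \<beta>) else 0)"
    unfolding mpoly_eval_tup3[OF F(1)]
  proof (intro sum.cong refl)
    fix \<beta> assume "\<beta> \<in> Poly_Mapping.keys F"
    then show "to_ac (Poly_Mapping.lookup F \<beta>) *
        (0 ^ Poly_Mapping.lookup \<beta> 0 * 0 ^ Poly_Mapping.lookup \<beta> 1 * 1 ^ Poly_Mapping.lookup \<beta> 2)
      = (if \<beta> = \<alpha> then to_ac (Poly_Mapping.lookup F \<beta>) else 0)"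
      using eq[of \<beta>] \<alpha>(2,3) by (cases "\<beta> = \<alpha>") (auto simp: power_0_left)
  qed
  then show ?thesis using \<alpha>(1) by (simp add: in_keys_iff)
qed

lemma dehom_nonzero:
  assumes "F \<in> mpolys 2" "weighted_homogeneous w d F" "0 < w 0" "F \<noteq> 0"
  shows "dehom F \<noteq> 0"
proof -
  obtain \<alpha> where "\<alpha> \<in> Poly_Mapping.keys F" using assms(4) by fastforce
  then show ?thesis using coeff_dehom_key[OF assms(1-3)] by (auto simp: in_keys_iff)
qed

text \<open>For equal weights the monomials without \<open>X\<^sub>0\<close> are those of top total degree in \<open>y\<close> and \<open>z\<close>, and the
invariant of \<open>(0:1:z)\<close> is \<open>z\<close> itself.\<close>

lemma homog_comp_dehom:
  fixes F :: "'a::field mpoly"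
  assumes F: "F \<in> mpolys 2" "weighted_homogeneous w (w 1 * k) F"
    and w: "w 0 = 1" "0 < w 1" "w 2 = w 1"
  shows "homog_comp (dehom F) k = infinity_poly 1 F"
proof (rule poly_eqI)
  fix j
  have deg: "Poly_Mapping.lookup \<alpha> 0 + w 1 * (Poly_Mapping.lookup \<alpha> 1 + Poly_Mapping.lookup \<alpha> 2) = w 1 * k"
    if "\<alpha> \<in> Poly_Mapping.keys F" for \<alpha>
    using weighted_degree_3[OF F that] w by (simp add: algebra_simps)
  have iff: "j \<le> k \<and> Poly_Mapping.lookup \<alpha> 1 = k - j \<and> Poly_Mapping.lookup \<alpha> 2 = j
      \<longleftrightarrow> Poly_Mapping.lookup \<alpha> 0 = 0 \<and> Poly_Mapping.lookup \<alpha> 2 = j"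
    if "\<alpha> \<in> Poly_Mapping.keys F" for \<alpha>
  proof
    assume "j \<le> k \<and> Poly_Mapping.lookup \<alpha> 1 = k - j \<and> Poly_Mapping.lookup \<alpha> 2 = j"
    then show "Poly_Mapping.lookup \<alpha> 0 = 0 \<and> Poly_Mapping.lookup \<alpha> 2 = j"
      using deg[OF that] by simp
  next
    assume *: "Poly_Mapping.lookup \<alpha> 0 = 0 \<and> Poly_Mapping.lookup \<alpha> 2 = j"
    then have "Poly_Mapping.lookup \<alpha> 1 + Poly_Mapping.lookup \<alpha> 2 = k"
      using deg[OF that] w by simp
    then show "j \<le> k \<and> Poly_Mapping.lookup \<alpha> 1 = k - j \<and> Poly_Mapping.lookup \<alpha> 2 = j"
      using * by linarith
  qed
  have "coeff (homog_comp (dehom F) k) j = (\<Sum>\<alpha>\<in>Poly_Mapping.keys F.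
      if j \<le> k \<and> Poly_Mapping.lookup \<alpha> 1 = k - j \<and> Poly_Mapping.lookup \<alpha> 2 = j
      then Poly_Mapping.lookup F \<alpha> else 0)"
    by (simp add: coeff_homog_comp coeff_dehom)
  also have "\<dots> = (\<Sum>\<alpha>\<in>Poly_Mapping.keys F. if Poly_Mapping.lookup \<alpha> 0 = 0 then
      (if Poly_Mapping.lookup \<alpha> 2 = j then Poly_Mapping.lookup F \<alpha> else 0) else 0)"
    using iff by (intro sum.cong refl) auto
  also have "\<dots> = coeff (infinity_poly 1 F) j"
    by (auto simp: infinity_poly_def coeff_sum sum.inter_filter intro!: sum.cong)
  finally show "coeff (homog_comp (dehom F) k) j = coeff (infinity_poly 1 F) j" .
qed

section \<open>Upper bounds\<close>

lemma card_V_2_eq: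
  fixes F :: "'a::{field,finite} mpoly"
  assumes w: "w 0 = 1" "0 < w 1" "0 < w 2"
    and F: "F \<in> mpolys 2" "weighted_homogeneous w (w 1 * k) F"
  shows "card (V w 2 F) = card (zeros2 (dehom F))
    + card {\<tau>. poly (infinity_poly (w 1 div gcd (w 1) (w 2)) F) \<tau> = 0}
    + (if mpoly_eval F (tup3 0 0 1) = 0 then 1 else 0)"
    and "\<And>\<alpha>. \<alpha> \<in> Poly_Mapping.keys F \<Longrightarrow> Poly_Mapping.lookup \<alpha> 0 = 0 \<Longrightarrow>
      w 1 div gcd (w 1) (w 2) dvd Poly_Mapping.lookup \<alpha> 2"
proof -
  define g where "g = gcd (w 1) (w 2)"
  define e where "e = w 1 div g"
  have "0 < g" using w by (simp add: g_def)
  have we: "w 1 = g * e" and wg: "w 2 = g * (w 2 div g)" by (auto simp: e_def g_def)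
  have "e > 0" using w we by auto
  have "coprime e (w 2 div g)"
    using div_gcd_coprime[of "w 1" "w 2"] w by (simp add: e_def g_def)
  show e: "w 1 div gcd (w 1) (w 2) dvd Poly_Mapping.lookup \<alpha> 2"
    if "\<alpha> \<in> Poly_Mapping.keys F" "Poly_Mapping.lookup \<alpha> 0 = 0" for \<alpha>
  proof -
    have "w 2 * Poly_Mapping.lookup \<alpha> 2 = w 1 * (k - Poly_Mapping.lookup \<alpha> 1)"
      using weighted_degree_3[OF F that(1)] that(2) by (simp add: diff_mult_distrib2)
    then have "w 1 dvd w 2 * Poly_Mapping.lookup \<alpha> 2" by simp
    then have "g * e dvd g * (w 2 div g * Poly_Mapping.lookup \<alpha> 2)"
      by (simp only: we [symmetric] mult.assoc [symmetric] wg [symmetric])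
    then have "e dvd w 2 div g * Poly_Mapping.lookup \<alpha> 2" using \<open>0 < g\<close> by simp
    then show ?thesis
      using \<open>coprime e (w 2 div g)\<close> by (simp add: coprime_dvd_mult_right_iff e_def g_def)
  qed
  have "\<forall>\<tau>. \<exists>z. z ^ e = (to_ac \<tau> :: 'a alg_closure)"
    using nth_root_exists[OF \<open>e > 0\<close>] by blast
  then obtain \<rho> where \<rho>: "\<And>\<tau> :: 'a. \<rho> \<tau> ^ e = to_ac \<tau>" by metis
  have "mpoly_eval F (tup3 0 1 (\<rho> \<tau>))
      = to_ac (poly (infinity_poly (w 1 div gcd (w 1) (w 2)) F) \<tau>)" for \<tau>
    by (rule mpoly_eval_infinity[OF F(1) e]) (use \<rho> in \<open>auto simp: e_def g_def\<close>)
  then show "card (V w 2 F) = card (zeros2 (dehom F))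
    + card {\<tau>. poly (infinity_poly (w 1 div gcd (w 1) (w 2)) F) \<tau> = 0}
    + (if mpoly_eval F (tup3 0 0 1) = 0 then 1 else 0)"
    unfolding card_V_2[OF w F \<rho>[unfolded e_def g_def]]
    by (simp add: mpoly_eval_affine[OF F(1)] zeros2_def)
qed

text \<open>The line count settles every case but the one in which no line \<open>y = c\<close> lies on the curve and \<open>z\<^sup>k\<close>
occurs. The weights are then equal, \<open>(0:0:1)\<close> is not a zero, and either there is no zero at
infinity or the pencil can be moved to one.\<close>

lemma card_V_2_le:
  fixes F :: "'a::{field,finite} mpoly"
  assumes w: "w 0 = 1" "0 < w 1" "w 1 \<le> w 2" and k: "0 < k" "k \<le> CARD('a)"
    and F: "F \<in> mpolys 2" "weighted_homogeneous w (w 1 * k) F" "F \<noteq> 0"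
  shows "card (V w 2 F) \<le> k * CARD('a) + 1"
proof -
  define e where "e = w 1 div gcd (w 1) (w 2)"
  define f where "f = dehom F"
  define H where "H = infinity_poly e F"
  define T where "T = card {\<tau>. poly H \<tau> = 0}"
  define I where "I = (if mpoly_eval F (tup3 0 0 1) = 0 then 1 else 0 :: nat)"
  have "0 < w 2" using w by simp
  note * = card_V_2_eq[OF w(1,2) this F(1,2), folded e_def, folded f_def H_def, folded T_def I_def]
  have "I \<le> 1" by (simp add: I_def)
  have deg: "w 1 * i + w 2 * j \<le> w 1 * k" if nz: "coeff (coeff f j) i \<noteq> 0" for i j
  proof -
    obtain \<beta> where "\<beta> \<in> Poly_Mapping.keys F" "Poly_Mapping.lookup \<beta> 1 = i" "Poly_Mapping.lookup \<beta> 2 = j"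
      using nz unfolding f_def by (rule coeff_dehom_nonzeroE)
    then show ?thesis using weighted_degree_3[OF F(1,2)] by fastforce
  qed
  have "f \<noteq> 0" using dehom_nonzero[OF F(1,2) _ F(3)] w by (simp add: f_def)
  obtain r where r: "r \<le> degree (lead_coeff f)" "r \<le> CARD('a)"
    "card (zeros2 f) \<le> r * CARD('a) + (CARD('a) - r) * degree f"
    using card_zeros2_le[OF \<open>f \<noteq> 0\<close>] .
  have "coeff (lead_coeff f) (degree (lead_coeff f)) \<noteq> 0" using \<open>f \<noteq> 0\<close> by simp
  \<comment> \<open>a monomial of \<open>F\<close> responsible for the leading coefficient; its weighted degree bounds \<open>r\<close> and \<open>degree f\<close>\<close>
  then obtain \<alpha> where \<alpha>: "\<alpha> \<in> Poly_Mapping.keys F"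
    "Poly_Mapping.lookup \<alpha> 1 = degree (lead_coeff f)" "Poly_Mapping.lookup \<alpha> 2 = degree f"
    unfolding f_def by (rule coeff_dehom_nonzeroE)
  have \<alpha>_deg: "Poly_Mapping.lookup \<alpha> 0 + w 1 * degree (lead_coeff f) + w 2 * degree f = w 1 * k"
    using weighted_degree_3[OF F(1,2) \<alpha>(1)] \<alpha> w by simp
  have rJ: "Poly_Mapping.lookup \<alpha> 0 + w 1 * r + w 2 * degree f \<le> w 1 * k"
    unfolding \<alpha>_deg[symmetric] using r(1) by simp
  have w12: "w 1 * degree f \<le> w 2 * degree f" using w by simp
  have "w 1 * (r + degree f) \<le> w 1 * k"
    using rJ w12 unfolding distrib_left by linarith
  then have rJk: "r + degree f \<le> k" using w by simp
  show ?thesis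
  proof (cases "H = 0")
    case True
    have "Poly_Mapping.lookup \<alpha> 0 \<noteq> 0"
    proof
      assume "Poly_Mapping.lookup \<alpha> 0 = 0"
      with *(2) \<alpha>(1) have "coeff H (Poly_Mapping.lookup \<alpha> 2 div e) = Poly_Mapping.lookup F \<alpha>"
        unfolding H_def by (intro coeff_infinity_poly_key[OF F(1,2) w(2)])
      then have "Poly_Mapping.lookup F \<alpha> = 0" using True by simp
      then show False using \<alpha>(1) by (simp add: in_keys_iff)
    qed
    then have "w 1 * (r + degree f) < w 1 * k"
      using rJ w12 unfolding distrib_left by linarith
    then have "r + degree f + 1 \<le> k" by simp
    then have "(r + degree f + 1) * CARD('a) \<le> k * CARD('a)" by (rule mult_le_mono1)
    moreover have "(CARD('a) - r) * degree f \<le> CARD('a) * degree f" by simp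
    moreover have "T \<le> CARD('a)" unfolding T_def by (intro card_mono) auto
    ultimately show ?thesis using * r(3) \<open>I \<le> 1\<close> by (simp add: algebra_simps)
  next
    case False
    have "degree H \<le> degree f"
    proof (rule degree_le, intro allI impI)
      fix t assume "degree f < t"
      have "Poly_Mapping.lookup \<beta> 2 div e \<noteq> t" if "\<beta> \<in> Poly_Mapping.keys F" for \<beta>
      proof -
        have "coeff (coeff f (Poly_Mapping.lookup \<beta> 2)) (Poly_Mapping.lookup \<beta> 1) \<noteq> 0"
          using coeff_dehom_key[OF F(1,2) _ that] w that by (simp add: f_def in_keys_iff)
        then have "Poly_Mapping.lookup \<beta> 2 \<le> degree f" by (intro le_degree) auto
        moreover have "Poly_Mapping.lookup \<beta> 2 div e \<le> Poly_Mapping.lookup \<beta> 2"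
          by (rule div_le_dividend)
        ultimately show ?thesis using \<open>degree f < t\<close> by linarith
      qed
      then show "coeff H t = 0" by (auto simp: H_def infinity_poly_def coeff_sum intro!: sum.neutral)
    qed
    then have T: "T \<le> degree f"
      using card_poly_roots_bound[OF False] by (simp add: T_def)
    show ?thesis
    proof (cases "r + degree f < k \<or> 0 < r")
      case True
      then have "card (zeros2 f) + (T + I) \<le> k * CARD('a) + 1"
        using T \<open>I \<le> 1\<close> by (intro pencil_bound[OF r(3) _ rJk _ r(2) k(2)]) auto
      then show ?thesis using * by simp
    next
      case False
      then have "r = 0" and J: "degree f = k" using rJk by auto
      then have "w 2 * k \<le> w 1 * k" using rJ[unfolded J] by linarith
      then have w21: "w 2 = w 1" using w k by simp
      then have "e = 1" using w by (simp add: e_def)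
      have "Poly_Mapping.lookup \<alpha> 0 = 0" "Poly_Mapping.lookup \<alpha> 1 = 0"
        using \<alpha>_deg \<alpha>(2) J w w21 by auto
      then have "I = 0"
        using mpoly_eval_001_nonzero[OF F(1,2) \<open>0 < w 2\<close> \<alpha>(1)] by (simp add: I_def)
      have H: "homog_comp f k = H"
        using homog_comp_dehom[OF F(1,2) w(1,2) w21] \<open>e = 1\<close> by (simp add: f_def H_def)
      show ?thesis
      proof (cases "\<exists>t. poly H t = 0")
        case True
        then obtain t where "poly H t = 0" by blast
        moreover have "total_degree_le k f"
          using deg w w21 by (auto simp: total_degree_le_def simp flip: distrib_left)
        ultimately have "card (zeros2 f) + T \<le> k * CARD('a) + 1"
          using card_zeros_plane_curve_le[of k f t] k \<open>H \<noteq> 0\<close> by (simp add: H T_def)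
        then show ?thesis using * \<open>I = 0\<close> by simp
      next
        case False
        then have "T = 0" by (simp add: T_def)
        then show ?thesis using * \<open>I = 0\<close> r(3) \<open>r = 0\<close> J by (simp add: mult.commute)
      qed
    qed
  qed
qed

lemma card_V_1_eq:
  fixes F :: "'a::{field,finite} mpoly"
  assumes w: "w 0 = 1" "0 < w 1"
    and F: "F \<in> mpolys 1" "weighted_homogeneous w (w 1 * k) F"
  shows "card (V w 1 F) = card {y. poly (coeff (dehom F) 0) y = 0}
    + (if coeff (coeff (dehom F) 0) k = 0 then 1 else 0)"
proof -
  have F2: "F \<in> mpolys 2" using F(1) mpolys_mono[of 1 2] by auto
  have affine: "mpoly_eval F (tup3 1 (to_ac y) 0) = to_ac (poly (coeff (dehom F) 0) y)" for y
    using mpoly_eval_affine[OF F2, of y 0] by (simp add: poly_0_coeff_0)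
  have z2: "Poly_Mapping.lookup \<alpha> 2 = 0" if "\<alpha> \<in> Poly_Mapping.keys F" for \<alpha>
    using F(1) that by (force simp: mpolys_def in_keys_iff subset_iff)
  have z0: "Poly_Mapping.lookup \<alpha> 0 = 0 \<longleftrightarrow> Poly_Mapping.lookup \<alpha> 1 = k" if "\<alpha> \<in> Poly_Mapping.keys F" for \<alpha>
    using weighted_degree_3[OF F2 F(2) that] z2[OF that] w by auto
  have "mpoly_eval F (tup3 0 1 0) = to_ac (coeff (coeff (dehom F) 0) k)"
    unfolding mpoly_eval_tup3[OF F2] coeff_dehom to_ac_sum
    using z0 z2 by (intro sum.cong refl) (auto simp: power_0_left)
  then show ?thesis
    unfolding card_V_1[OF w F] by (simp add: affine)
qed

text \<open>A zero at \<open>(0:1)\<close> lowers the degree of the dehomogenised polynomial, so it is paid for by one affine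
zero.\<close>

lemma card_V_1_le:
  fixes F :: "'a::{field,finite} mpoly"
  assumes w: "w 0 = 1" "0 < w 1"
    and F: "F \<in> mpolys 1" "weighted_homogeneous w (w 1 * k) F" "F \<noteq> 0"
  shows "card (V w 1 F) \<le> k"
proof -
  define p where "p = coeff (dehom F) 0"
  have F2: "F \<in> mpolys 2" using F(1) mpolys_mono[of 1 2] by auto
  obtain \<alpha> where \<alpha>: "\<alpha> \<in> Poly_Mapping.keys F" using F(3) by fastforce
  then have "Poly_Mapping.lookup \<alpha> 2 = 0"
    using F(1) by (force simp: mpolys_def in_keys_iff subset_iff)
  then have "coeff p (Poly_Mapping.lookup \<alpha> 1) \<noteq> 0"
    using coeff_dehom_key[OF F2 F(2) _ \<alpha>] w \<alpha> by (simp add: p_def in_keys_iff)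
  then have "p \<noteq> 0" by auto
  have "degree p \<le> k"
  proof (rule degree_le, intro allI impI, rule ccontr)
    fix i assume "k < i" "coeff p i \<noteq> 0"
    then obtain \<beta> where \<beta>: "\<beta> \<in> Poly_Mapping.keys F" "Poly_Mapping.lookup \<beta> 1 = i"
      unfolding p_def by (blast elim: coeff_dehom_nonzeroE)
    then have "w 1 * i \<le> w 1 * k"
      using weighted_degree_3[OF F2 F(2) \<beta>(1), unfolded \<beta>(2)] by linarith
    then show False using \<open>k < i\<close> w by simp
  qed
  moreover have "degree p < k" if "coeff p k = 0"
    using that \<open>p \<noteq> 0\<close> \<open>degree p \<le> k\<close> by (metis leading_coeff_0_iff le_neq_implies_less)
  ultimately show ?thesis
    using card_poly_roots_bound[OF \<open>p \<noteq> 0\<close>] unfolding card_V_1_eq[OF w F(1,2)] p_def[symmetric]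
    by auto
qed

lemma card_V_2_trivial_bound:
  fixes F :: "'a::{field,finite} mpoly"
  assumes w: "w 0 = 1" "0 < w 1" "0 < w 2"
    and F: "F \<in> mpolys 2" "weighted_homogeneous w (w 1 * k) F"
  shows "card (V w 2 F) \<le> CARD('a) * CARD('a) + CARD('a) + 1"
proof -
  have "card (zeros2 (dehom F)) \<le> card (UNIV :: ('a \<times> 'a) set)"
    by (intro card_mono) auto
  moreover have "card {\<tau>. poly (infinity_poly (w 1 div gcd (w 1) (w 2)) F) \<tau> = 0} \<le> CARD('a)"
    by (intro card_mono) auto
  ultimately show ?thesis
    unfolding card_V_2_eq(1)[OF w F] by (simp add: card_prod)
qed

lemma card_V_1_trivial_bound:
  fixes F :: "'a::{field,finite} mpoly"
  assumes w: "w 0 = 1" "0 < w 1"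
    and F: "F \<in> mpolys 1" "weighted_homogeneous w (w 1 * k) F"
  shows "card (V w 1 F) \<le> CARD('a) + 1"
proof -
  have "card {y. poly (coeff (dehom F) 0) y = 0} \<le> CARD('a)"
    by (intro card_mono) auto
  then show ?thesis unfolding card_V_1_eq[OF w F] by simp
qed

section \<open>Forms with many zeros\<close>

definition binary_exps :: "nat \<Rightarrow> nat \<Rightarrow> nat \<Rightarrow> nat \<Rightarrow>\<^sub>0 nat" where
  "binary_exps a k i = Poly_Mapping.single 0 (a * (k - i)) + Poly_Mapping.single 1 i"

lemma lookup_binary_exps:
  "Poly_Mapping.lookup (binary_exps a k i) 0 = a * (k - i)"
  "Poly_Mapping.lookup (binary_exps a k i) 1 = i"
  "Poly_Mapping.lookup (binary_exps a k i) 2 = 0"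
  by (simp_all add: binary_exps_def lookup_add lookup_single)

lemma inj_binary_exps: "inj (binary_exps a k)"
  by (rule injI) (metis lookup_binary_exps(2))

lemma keys_binary_exps: "Poly_Mapping.keys (binary_exps a k i) \<subseteq> {0, 1}"
  unfolding binary_exps_def using Poly_Mapping.keys_add by (fastforce split: if_splits)

text \<open>The form of degree \<open>ak\<close> in \<open>X\<^sub>0\<close> and \<open>X\<^sub>1\<close> (of weights 1 and \<open>a\<close>) that dehomogenises to \<open>p(y)\<close>, if
\<open>p\<close> has degree at most \<open>k\<close>. It provides the extremal examples for both dimensions.\<close>

definition binary_form :: "nat \<Rightarrow> nat \<Rightarrow> 'a::field poly \<Rightarrow> 'a mpoly" where
  "binary_form a k p = (\<Sum>i\<le>k. Poly_Mapping.single (binary_exps a k i) (coeff p i))"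

lemma lookup_binary_form:
  "Poly_Mapping.lookup (binary_form a k p) (binary_exps a k i) = (if i \<le> k then coeff p i else 0)"
  by (simp add: binary_form_def lookup_sum lookup_single when_def inj_eq[OF inj_binary_exps])

lemma keys_binary_form: "Poly_Mapping.keys (binary_form a k p) \<subseteq> binary_exps a k ` {..k}"
proof
  fix \<alpha> assume "\<alpha> \<in> Poly_Mapping.keys (binary_form a k p)"
  then have "(\<Sum>i\<le>k. Poly_Mapping.lookup (Poly_Mapping.single (binary_exps a k i) (coeff p i)) \<alpha>) \<noteq> 0"
    by (simp add: binary_form_def in_keys_iff lookup_sum)
  then obtain i where "i \<in> {..k}"
    "Poly_Mapping.lookup (Poly_Mapping.single (binary_exps a k i) (coeff p i)) \<alpha> \<noteq> 0"
    by (rule sum.not_neutral_contains_not_neutral)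
  then show "\<alpha> \<in> binary_exps a k ` {..k}"
    by (auto simp: lookup_single when_def split: if_splits)
qed

lemma binary_form_mpolys: "1 \<le> m \<Longrightarrow> binary_form a k p \<in> mpolys m"
  using keys_binary_form keys_binary_exps unfolding mpolys_def by fastforce

lemma binary_form_weighted_homogeneous:
  assumes "w 0 = 1"
  shows "weighted_homogeneous w (w 1 * k) (binary_form (w 1) k p)"
  unfolding weighted_homogeneous_def
proof
  fix \<alpha> assume "\<alpha> \<in> Poly_Mapping.keys (binary_form (w 1) k p)"
  then obtain i where i: "i \<le> k" "\<alpha> = binary_exps (w 1) k i" using keys_binary_form by blast
  have "(\<Sum>j\<in>Poly_Mapping.keys \<alpha>. w j * Poly_Mapping.lookup \<alpha> j)
      = (\<Sum>j\<in>{0, 1}. w j * Poly_Mapping.lookup \<alpha> j)"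
    using keys_binary_exps by (intro sum.mono_neutral_left) (auto simp: i in_keys_iff)
  also have "\<dots> = w 0 * Poly_Mapping.lookup \<alpha> 0 + w 1 * Poly_Mapping.lookup \<alpha> 1" by simp
  also have "\<dots> = w 1 * (k - i) + w 1 * i"
    unfolding i(2) lookup_binary_exps by (simp add: assms)
  also have "\<dots> = w 1 * k" using i(1) by (simp flip: distrib_left)
  finally show "(\<Sum>j\<in>Poly_Mapping.keys \<alpha>. w j * Poly_Mapping.lookup \<alpha> j) = w 1 * k" .
qed

lemma binary_form_nonzero:
  assumes "p \<noteq> 0" "degree p \<le> k"
  shows "binary_form a k p \<noteq> 0"
proof
  assume "binary_form a k p = 0"
  then have "coeff p (degree p) = 0"
    using lookup_binary_form[of a k p "degree p"] assms(2) by simp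
  then show False using assms(1) by simp
qed

lemma mpoly_eval_binary_form:
  "mpoly_eval (binary_form a k p) (tup3 x y z) = (\<Sum>i\<le>k. to_ac (coeff p i) * (x ^ (a * (k - i)) * y ^ i))"
proof -
  have "mpoly_eval (binary_form a k p) (tup3 x y z)
    = (\<Sum>\<alpha>\<in>binary_exps a k ` {..k}. to_ac (Poly_Mapping.lookup (binary_form a k p) \<alpha>) *
       (x ^ Poly_Mapping.lookup \<alpha> 0 * y ^ Poly_Mapping.lookup \<alpha> 1 * z ^ Poly_Mapping.lookup \<alpha> 2))"
    unfolding mpoly_eval_tup3[OF binary_form_mpolys[of 2, simplified]]
    by (intro sum.mono_neutral_left keys_binary_form) (auto simp: in_keys_iff)
  also have "\<dots> = (\<Sum>i\<le>k. to_ac (coeff p i) * (x ^ (a * (k - i)) * y ^ i))"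
    using inj_on_subset[OF inj_binary_exps[of a k]]
    by (subst sum.reindex) (auto simp del: One_nat_def simp: lookup_binary_form lookup_binary_exps)
  finally show ?thesis .
qed

lemma mpoly_eval_binary_form_affine:
  assumes "degree p \<le> k"
  shows "mpoly_eval (binary_form a k p) (tup3 1 (to_ac y) z) = to_ac (poly p y)"
  by (simp add: mpoly_eval_binary_form poly_eq_sum_le[OF assms] to_ac_sum)

lemma mpoly_eval_binary_form_infinity:
  assumes "0 < a"
  shows "mpoly_eval (binary_form a k p) (tup3 0 y z) = to_ac (coeff p k) * y ^ k"
proof -
  have "mpoly_eval (binary_form a k p) (tup3 0 y z)
    = (\<Sum>i\<le>k. if i = k then to_ac (coeff p i) * y ^ i else 0)"
    unfolding mpoly_eval_binary_form using assms by (intro sum.cong refl) (auto simp: power_0_left)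
  then show ?thesis by simp
qed

text \<open>A product of \<open>min k q\<close> distinct linear factors. For \<open>k > q\<close> its degree is less than \<open>k\<close>, and the form
belonging to it then vanishes identically on \<open>x\<^sub>0 = 0\<close>.\<close>

lemma ex_poly_roots:
  fixes k :: nat
  obtains p :: "'a::{field,finite} poly" where "p \<noteq> 0" "degree p \<le> k"
    "card {y. poly p y = 0} = min k (CARD('a))" "coeff p k = 0 \<longleftrightarrow> CARD('a) < k"
proof -
  obtain C :: "'a set" where C: "card C = min k (CARD('a))" "finite C"
    using obtain_subset_with_card_n[of "min k (CARD('a))" "UNIV :: 'a set"] by auto
  define p where "p = (\<Prod>c\<in>C. [:-c, 1:])"
  have deg: "degree p = card C" by (simp add: p_def degree_prod_eq_sum_degree)
  have lc: "lead_coeff p = 1" by (simp add: p_def lead_coeff_prod)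
  then have "p \<noteq> 0" by auto
  have "{y. poly p y = 0} = C" using C(2) by (auto simp: p_def poly_prod)
  moreover have "coeff p k = 0 \<longleftrightarrow> CARD('a) < k"
  proof (cases "CARD('a) < k")
    case True
    then show ?thesis using deg C(1) by (simp add: coeff_eq_0)
  next
    case False
    then have "degree p = k" using deg C(1) by simp
    then show ?thesis using lc False by auto
  qed
  ultimately show ?thesis using that[of p] \<open>p \<noteq> 0\<close> deg C(1) by auto
qed

text \<open>For \<open>k \<le> q\<close> the zeros are those on \<open>k\<close> affine lines \<open>y = c\<close> and the point \<open>(0:0:1)\<close>; for \<open>k > q\<close> every rational point
is a zero. The two values agree with the minimum, since \<open>kq + 1\<close> exceeds \<open>q\<^sup>2 + q\<close> exactly
when \<open>k > q\<close>.\<close>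

lemma card_V_2_attained:
  assumes w: "w 0 = 1" "0 < w 1" "0 < w 2" and "0 < k"
  shows "\<exists>F :: 'a::{field,finite} mpoly. F \<in> mpolys 2 \<and> F \<noteq> 0 \<and> weighted_homogeneous w (w 1 * k) F
    \<and> card (V w 2 F) = min (CARD('a) * CARD('a) + CARD('a) + 1) (k * CARD('a) + 1)"
proof -
  obtain p :: "'a poly" where p: "p \<noteq> 0" "degree p \<le> k"
    "card {y. poly p y = 0} = min k (CARD('a))" "coeff p k = 0 \<longleftrightarrow> CARD('a) < k"
    by (rule ex_poly_roots)
  define F where "F = binary_form (w 1) k p"
  have F: "F \<in> mpolys 2" "weighted_homogeneous w (w 1 * k) F" "F \<noteq> 0"
    unfolding F_def
    using binary_form_mpolys[of 2 "w 1" k p] binary_form_weighted_homogeneous[of w k p, OF w(1)]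
      binary_form_nonzero[OF p(1,2), of "w 1"] by simp_all
  have "0 < w 1 div gcd (w 1) (w 2)" using w by (simp add: div_greater_zero_iff dvd_imp_le)
  then have "\<forall>\<tau>. \<exists>z. z ^ (w 1 div gcd (w 1) (w 2)) = (to_ac \<tau> :: 'a alg_closure)"
    using nth_root_exists by blast
  then obtain \<rho> where \<rho>: "\<And>\<tau> :: 'a. \<rho> \<tau> ^ (w 1 div gcd (w 1) (w 2)) = to_ac \<tau>" by metis
  have "{(y, z :: 'a). poly p y = 0} = {y. poly p y = 0} \<times> UNIV" by auto
  then have "card {(y, z :: 'a). poly p y = 0} = min k (CARD('a)) * CARD('a)"
    by (simp only: card_cartesian_product p(3))
  then have "card (V w 2 F) = min k (CARD('a)) * CARD('a) + card {\<tau> :: 'a. coeff p k = 0} + 1"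
    unfolding card_V_2[OF w F(1,2) \<rho>]
    using \<open>0 < k\<close> w(2)
    by (simp add: F_def mpoly_eval_binary_form_affine[OF p(2)] mpoly_eval_binary_form_infinity del: One_nat_def)
  also have "\<dots> = min (CARD('a) * CARD('a) + CARD('a) + 1) (k * CARD('a) + 1)"
  proof (cases "CARD('a) < k")
    case True
    then have "Suc (CARD('a)) * CARD('a) \<le> k * CARD('a)" by (intro mult_le_mono1) simp
    then show ?thesis using True p(4) by simp
  next
    case False
    then have "k * CARD('a) \<le> CARD('a) * CARD('a)" by (intro mult_le_mono1) simp
    then have "min (CARD('a) * CARD('a) + CARD('a) + 1) (k * CARD('a) + 1) = k * CARD('a) + 1"
      by (intro min_absorb2) linarith
    then show ?thesis using False p(4) by simp
  qed
  finally show ?thesis using F by blast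
qed

lemma card_V_1_attained:
  assumes w: "w 0 = 1" "0 < w 1"
  shows "\<exists>F :: 'a::{field,finite} mpoly. F \<in> mpolys 1 \<and> F \<noteq> 0 \<and> weighted_homogeneous w (w 1 * k) F
    \<and> card (V w 1 F) = min (CARD('a) + 1) k"
proof -
  obtain p :: "'a poly" where p: "p \<noteq> 0" "degree p \<le> k"
    "card {y. poly p y = 0} = min k (CARD('a))" "coeff p k = 0 \<longleftrightarrow> CARD('a) < k"
    by (rule ex_poly_roots)
  define F where "F = binary_form (w 1) k p"
  have F: "F \<in> mpolys 1" "weighted_homogeneous w (w 1 * k) F" "F \<noteq> 0"
    unfolding F_def
    using binary_form_mpolys[of 1 "w 1" k p] binary_form_weighted_homogeneous[of w k p, OF w(1)]
      binary_form_nonzero[OF p(1,2), of "w 1"] by simp_all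
  have "card (V w 1 F) = min k (CARD('a)) + (if coeff p k = 0 then 1 else 0)"
    unfolding card_V_1[OF w F(1,2)] using w(2)
    by (simp add: F_def mpoly_eval_binary_form_affine[OF p(2)] mpoly_eval_binary_form_infinity p(3) del: One_nat_def)
  also have "\<dots> = min (CARD('a) + 1) k" using p(4) by auto
  finally show ?thesis using F by blast
qed

section \<open>The maximal number of zeros\<close>

lemma e_max_eqI:
  assumes upper: "\<And>F :: 'a::{field,finite} mpoly. F \<in> mpolys m \<Longrightarrow> F \<noteq> 0 \<Longrightarrow>
      weighted_homogeneous w d F \<Longrightarrow> card (V w m F) \<le> N"
    and attained: "\<exists>F :: 'a mpoly. F \<in> mpolys m \<and> F \<noteq> 0 \<and> weighted_homogeneous w d F \<and> card (V w m F) = N"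
  shows "e_max TYPE('a) d w m = N"
  unfolding e_max_def
proof (rule Max_eqI)
  show "finite {card (V w m F) |F :: 'a mpoly. F \<in> mpolys m \<and> F \<noteq> 0 \<and> weighted_homogeneous w d F}"
    by (rule finite_subset[of _ "{..N}"]) (use upper in auto)
qed (use upper attained in auto)

theorem theorem1:
  fixes q d m :: nat and a :: "nat \<Rightarrow> nat"
  assumes "q = CARD('a::{field,finite})"
    and "1 \<le> m" and "m \<le> 2"
    and "m = 2 \<Longrightarrow> d > 0"
    and "a 0 = 1"
    and "\<And>i. 1 \<le> i \<Longrightarrow> i \<le> m \<Longrightarrow> a i > 0"
    and "\<And>i j. 1 \<le> i \<Longrightarrow> i \<le> j \<Longrightarrow> j \<le> m \<Longrightarrow> a i \<le> a j"
    and "(LCM i\<in>{1..m}. a i) dvd d"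
  shows "real (e_max TYPE('a) d a m) =
    min (real (p_num q (int m)))
        (real d / real (a 1) * real q ^ (m - 1) + real (p_num q (int m - 2)))"
proof -
  have "a 1 dvd (LCM i\<in>{1..m}. a i)" using \<open>1 \<le> m\<close> by (intro dvd_Lcm) auto
  then obtain k where d: "d = a 1 * k" using assms(8) dvd_trans by blast
  have a1: "0 < a 1" using assms(2,6) by auto
  consider "m = 1" | "m = 2" using assms(2,3) by linarith
  then show ?thesis
  proof cases
    case 1
    have "e_max TYPE('a) d a m = min (q + 1) k"
      unfolding 1 d assms(1)
    proof (rule e_max_eqI[OF _ card_V_1_attained[of a k, OF assms(5) a1]])
      fix F :: "'a mpoly" assume F: "F \<in> mpolys 1" "F \<noteq> 0" "weighted_homogeneous a (a 1 * k) F"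
      show "card (V a 1 F) \<le> min (CARD('a) + 1) k"
        using card_V_1_le[OF assms(5) a1 F(1,3,2)] card_V_1_trivial_bound[OF assms(5) a1 F(1,3)]
        by (rule min.boundedI [rotated])
    qed
    then show ?thesis using a1 by (simp add: 1 d p_num_def)
  next
    case 2
    have a2: "0 < a 2" "a 1 \<le> a 2" using assms(6,7) 2 by auto
    have "0 < k" using assms(4)[OF 2] d by simp
    have "card (V a 2 F) \<le> min (CARD('a) * CARD('a) + CARD('a) + 1) (k * CARD('a) + 1)"
      if F: "F \<in> mpolys 2" "F \<noteq> 0" "weighted_homogeneous a (a 1 * k) F" for F :: "'a mpoly"
    proof (cases "k \<le> CARD('a)")
      case True
      then show ?thesis
        using card_V_2_le[OF assms(5) a1 a2(2) \<open>0 < k\<close> True F(1,3,2)]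
          card_V_2_trivial_bound[OF assms(5) a1 a2(1) F(1,3)] by simp
    next
      case False
      then have "Suc (CARD('a)) * CARD('a) \<le> k * CARD('a)" by (intro mult_le_mono1) simp
      then show ?thesis
        using card_V_2_trivial_bound[OF assms(5) a1 a2(1) F(1,3)] by simp
    qed
    then have "e_max TYPE('a) d a m = min (q * q + q + 1) (k * q + 1)"
      unfolding 2 d assms(1)
      by (intro e_max_eqI card_V_2_attained[OF assms(5) a1 a2(1) \<open>0 < k\<close>])
    moreover have "p_num q (int m) = q * q + q + 1" "p_num q (int m - 2) = 1"
      by (simp_all add: 2 p_num_def eval_nat_numeral)
    moreover have "real d / real (a 1) * real q ^ (m - 1) = real (k * q)"
      using a1 by (simp add: 2 d)
    ultimately show ?thesis by (simp only: of_nat_min of_nat_add)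
  qed
qed

end
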